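(* Let $\bar Z\subseteq Z$ be an arbitrary set of providers and $\bar H\subseteq H$ a set of assisting peers, with $x=|\bar H|/\eta$, and consider the coalition $C=\bar Z\cup\bar H$. As $\eta\to\infty$ (with $x$ unchanged), the Aumann–Drèze payoffs of the players in $C$ (divided by $\eta$ for providers, not divided for peers) converge to $$\widetilde\varphi_p^{\bar Z}(x)=\widetilde\Omega_p(0)-\sum_{S\subseteq\bar Z\setminus\{p\}}\int_0^1 u^{|S|}(1-u)^{|\bar Z|-1-|S|}\Big(M_\Omega^{S\cup\{p\}}(ux)-M_\Omega^{S}(ux)\Big)\,du\qquad\text{for } p\in\bar Z,$$ $$\widetilde\varphi_n^{\bar Z}(x)=-\sum_{S\subseteq\bar Z}\int_0^1 u^{|S|}(1-u)^{|\bar Z|-|S|}\,\frac{dM_\Omega^S}{dx}(ux)\,du\qquad\text{for } n\in\bar H,$$ where $M_\Omega^S(x):=\min\{\sum_{i\in S}\widetilde\Omega_i(y_i)\mid \sum_{i\in S}y_i\le x,\ y_i\ge 0\}$ and $M_\Omega^{\emptyset}(x):=0$. (Note that $M_\Omega^{\{p\}}(x)=\widetilde\Omega_p(x)$.)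
   Context: Players: a finite set $Z$ of providers and a set $H$ of $\eta$ homogeneous peers, $N=Z\cup H$. For $p\in Z$, $\Omega_p^\eta(x)$ is the (nonnegative) operational cost of provider $p$ when a fraction $x$ of the $\eta$ peers assists it; it is non-increasing in $x$. For a coalition $S$ with exactly one provider $p$, $\hat v(S)=\Omega_p^\eta(0)-\Omega_p^\eta(|S\cap H|/\eta)$; for $S$ with no provider, $\hat v(S)=0$. The worth function is $v(S)=\hat v(S)$ if $S$ has at most one provider and otherwise $v(S)=\max\{\sum_{C\in\mathcal P}\hat v(C)\mid\mathcal P$ a partition of $S$ with exactly one provider in each $C\in\mathcal P\}$. The Shapley value of a game $(N,v)$ is $\varphi_i(N,v)=\sum_{S\subseteq N\setminus\{i\}}\frac{|S|!(|N|-|S|-1)!}{|N|!}(v(S\cup\{i\})-v(S))$. The Aumann–Drèze payoff of a player $i$ belonging to a coalition $C$ of a coalition structure (a partition of $N$) is the Shapley value of $i$ in the reduced game $(C,v)$ with player set $C$. Fluid limit: for every $p\in Z$, $\lim_{\eta\to\infty}\frac1\eta\Omega_p^\eta(\cdot)=\widetilde\Omega_p(\cdot)$, where $\widetilde\Omega_p\ge 0$ is assumed not constant on $[0,1]$. A tilde on a provider's payoff denotes the payoff divided by $\eta$, and dropping $\eta$ denotes the limit.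
   Formalization: For the peer formula it is additionally assumed that each M_Ω^S, S⊆Z̄, is absolutely continuous on [0,x] and differentiable a.e. (the formula fails for step-function costs); the minimum in M_Ω^S is read as an infimum, and the remark M_Ω^{p}=Ω̃_p is not restated. *)

theory Defs
  imports "HOL-Analysis.Analysis" "HOL-Library.Disjoint_Sets"
begin

definition shapley :: "'a set \<Rightarrow> ('a set \<Rightarrow> real) \<Rightarrow> 'a \<Rightarrow> real" where
  "shapley N v i =
     (\<Sum>S\<in>Pow (N - {i}).
        fact (card S) * fact (card N - card S - 1) / fact (card N) * (v (S \<union> {i}) - v S))"

text \<open>The payoff of player \<open>i\<close> under the coalition structure \<open>P\<close>: its Shapley value in the
  reduced game on its own block.\<close>

definition aumann_dreze :: "'a set set \<Rightarrow> ('a set \<Rightarrow> real) \<Rightarrow> 'a \<Rightarrow> real" where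
  "aumann_dreze P v i = shapley (THE C. C \<in> P \<and> i \<in> C) v i"

text \<open>In the next two definitions \<open>Z\<close> is the set of providers, \<open>H\<close> the set of peers,
  \<open>\<eta> = card H\<close>, and \<open>\<Omega> p \<eta> x\<close> is the cost of provider \<open>p\<close> when the fraction \<open>x\<close> of the
  \<open>\<eta>\<close> peers assists it. The value of \<open>v_hat\<close> on a coalition with several providers
  is immaterial: \<open>worth\<close> never uses it.\<close>

definition v_hat :: "'a set \<Rightarrow> 'a set \<Rightarrow> ('a \<Rightarrow> nat \<Rightarrow> real \<Rightarrow> real) \<Rightarrow> 'a set \<Rightarrow> real" where
  "v_hat Z H \<Omega> S =
     (if card (S \<inter> Z) = 1
      then (let p = the_elem (S \<inter> Z)
            in \<Omega> p (card H) 0 - \<Omega> p (card H) (real (card (S \<inter> H)) / real (card H)))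
      else 0)"

definition worth :: "'a set \<Rightarrow> 'a set \<Rightarrow> ('a \<Rightarrow> nat \<Rightarrow> real \<Rightarrow> real) \<Rightarrow> 'a set \<Rightarrow> real" where
  "worth Z H \<Omega> S =
     (if card (S \<inter> Z) \<le> 1 then v_hat Z H \<Omega> S
      else Max {\<Sum>C\<in>P. v_hat Z H \<Omega> C | P. partition_on S P \<and> (\<forall>C\<in>P. card (C \<inter> Z) = 1)})"

text \<open>\<open>M_Omega W S x\<close> is the minimum of \<open>\<Sum>i\<in>S. W i (y i)\<close> over the allocations \<open>y \<ge> 0\<close> with
  \<open>\<Sum>i\<in>S. y i \<le> x\<close>. It is written as an infimum: this is the minimum whenever the latter is
  attained (as it is for continuous \<open>W i\<close>), and it keeps the definition meaningful otherwise.\<close>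

definition M_Omega :: "('a \<Rightarrow> real \<Rightarrow> real) \<Rightarrow> 'a set \<Rightarrow> real \<Rightarrow> real" where
  "M_Omega W S x =
     (if S = {} then 0
      else (INF y \<in> {y. (\<forall>i\<in>S. 0 \<le> y i) \<and> (\<Sum>i\<in>S. y i) \<le> x}. \<Sum>i\<in>S. W i (y i)))"

text \<open>Absolute continuity of a function on a real interval, not to be confused with
  \<^const>\<open>absolutely_continuous\<close> of measures. The sets in \<open>D\<close> are finitely many compact intervals
  with pairwise disjoint interiors; the interval \<open>k\<close> has end points \<open>Inf k\<close> and \<open>Sup k\<close>.\<close>

definition abs_continuous_on :: "real set \<Rightarrow> (real \<Rightarrow> real) \<Rightarrow> bool" where
  "abs_continuous_on I f \<longleftrightarrow>
     (\<forall>\<epsilon>>0. \<exists>\<delta>>0. \<forall>D. D division_of \<Union>D \<and> \<Union>D \<subseteq> I \<and> (\<Sum>k\<in>D. Sup k - Inf k) < \<delta>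
        \<longrightarrow> (\<Sum>k\<in>D. \<bar>f (Sup k) - f (Inf k)\<bar>) < \<epsilon>)"

text \<open>The sense in which the derivative of \<open>f\<close> is required to exist on \<open>[0, x]\<close>: \<open>f\<close> is absolutely
  continuous there, i.e. the integral of its almost-everywhere derivative. Almost-everywhere
  differentiability follows from absolute continuity (Lebesgue) and is spelled out only because
  that theorem is not in the library. Every nonincreasing function that is continuous on \<open>[0, x]\<close>
  and differentiable at all but countably many points of \<open>(0, x)\<close> qualifies.\<close>

definition derivative_regular :: "real \<Rightarrow> (real \<Rightarrow> real) \<Rightarrow> bool" where
  "derivative_regular x f \<longleftrightarrow>
     abs_continuous_on {0..x} f \<and>
     negligible {t \<in> {0<..<x}. \<not> f differentiable (at t)}"

end

theory Submission
  imports Defs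
begin

text \<open>The worth of a coalition with providers \<open>T\<close> and \<open>k\<close> peers is
  \<open>\<Sum>i\<in>T. \<Omega>\<^sub>i(0)\<close> minus the least cost \<open>m\<^sub>T(k)\<close> of distributing at most \<open>k\<close> peers among \<open>T\<close>. Grouping the
  coalitions in the Shapley value by \<open>T\<close> and \<open>k\<close> turns the Shapley weights into beta-binomial
  weights, which concentrate: weighted sums of a bounded array \<open>m(k)\<close> converge to
  \<open>\<integral> u\<^sup>a (1-u)\<^sup>b F(u) du\<close> as soon as \<open>m(\<lfloor>(h+1)u\<rfloor>) \<longlongrightarrow> F(u)\<close> for almost all \<open>u\<close>. The latter holds for
  \<open>m\<^sub>T/\<eta>\<close> at every continuity point of the monotone function \<open>M_Omega\<close>, so the fluid costs
  need not be continuous for the provider payoffs.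

  A peer's marginal contribution is a difference \<open>m\<^sub>T(k) - m\<^sub>T(k+1)\<close> without the factor \<open>1/\<eta>\<close>, whose
  pointwise limit need not exist. Summation by parts moves the difference onto the weights,
  which yields weighted sums of the above kind; integrating back by parts in the limit uses the
  fundamental theorem of calculus for absolutely continuous functions.\<close>

text \<open>The Shapley weight of a coalition of \<open>s\<close> out of \<open>m\<close> other
  players is the integral of u^s (1-u)^(m-s) over [0, 1]: the marginal contribution is averaged over
  random coalitions that each other player joins independently with probability u, for u uniform.
  Given u, the number of peers is binomial and concentrates near u times the number of peers, while
  the boundedly many providers stay random. Hence the sum over provider sets, with one exponent
  counting the other providers inside and the other those outside.

  The obstacle is at the end points. Convergence for almost all u suffices for the integrals, but
  summation by parts also leaves values at k = 0 and at the full number of peers. The former is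
  immediate; the latter needs convergence at the single point \<open>x\<close>. Regularity of
  \<open>M_Omega\<close> for singletons enters there: it makes every fluid cost continuous on
  [0, x], and this makes \<open>M_Omega\<close> of the cut-off costs continuous at \<open>x\<close>.

  All this needs the number of peers to grow, so \<open>x = 0\<close> is computed
  separately.\<close>

section \<open>Absolutely continuous functions\<close>

text \<open>A gauge may treat each tag separately, so a derivative that is neither bounded nor known
  to be integrable causes no difficulty, and integrability of \<open>g\<close> is part of the
  conclusion. Absolute continuity excludes functions like Cantor's, whose derivative vanishes off a
  null set although the function grows.\<close>

lemma abs_continuous_on_has_integral:
  fixes f g :: "real \<Rightarrow> real"
  assumes ab: "a \<le> b" and ac: "abs_continuous_on {a..b} f" and N: "negligible N"
    and der: "\<And>t. t \<in> {a..b} - N \<Longrightarrow> (f has_real_derivative g t) (at t within {a..b})"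
  shows "(g has_integral f b - f a) {a..b}"
proof (cases "a = b")
  case True
  then show ?thesis by auto
next
  case False
  with ab have ab: "a < b" by simp
  \<comment> \<open>With the value 0 at tags in \<open>N\<close>, the intervals tagged there
    contribute only their increments of \<open>f\<close>, whatever \<open>g\<close> does on
    \<open>N\<close>.\<close>
  define G where "G t = (if t \<in> N then 0 else g t)" for t
  have "(G has_integral f b - f a) (cbox a b)"
    unfolding has_integral
  proof (intro allI impI)
    fix e :: real assume "e > 0"
    \<comment> \<open>Half of \<open>e\<close> pays for the tags outside \<open>N\<close>, whose
      intervals have total length at most \<open>b - a\<close>; the other half pays for the
      increments tagged in \<open>N\<close>.\<close>
    define e' where "e' = e / (2 * (b - a))"
    have e': "e' > 0" using \<open>e > 0\<close> ab by (simp add: e'_def)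
    obtain \<delta> where "\<delta> > 0" and \<delta>: "\<And>D. D division_of \<Union>D \<Longrightarrow> \<Union>D \<subseteq> {a..b} \<Longrightarrow>
        (\<Sum>k\<in>D. Sup k - Inf k) < \<delta> \<Longrightarrow> (\<Sum>k\<in>D. \<bar>f (Sup k) - f (Inf k)\<bar>) < e / 2"
      using ac \<open>e > 0\<close> unfolding abs_continuous_on_def by (meson half_gt_zero)
    have Nl: "N \<in> sets lebesgue" "emeasure lebesgue N = 0"
      using N by (auto simp: negligible_iff_null_sets null_sets_def)
    obtain U where U: "open U" "N \<subseteq> U" "U - N \<in> lmeasurable" "emeasure lebesgue (U - N) < ennreal \<delta>"
      using sets_lebesgue_outer_open[OF Nl(1) \<open>\<delta> > 0\<close>] by blast
    have UN: "(U - N) \<union> N = U" using U by auto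
    have Um: "U \<in> lmeasurable"
      using fmeasurable.Un[OF U(3) negligible_imp_measurable[OF N]] UN by simp
    have "emeasure lebesgue U = emeasure lebesgue (U - N)"
      using emeasure_Un_null_set[of "U - N" lebesgue N] U Nl UN by (auto simp: null_sets_def fmeasurable_def)
    with U(4) have "emeasure lebesgue U < ennreal \<delta>" by simp
    then have Ud: "measure lebesgue U < \<delta>"
      using Um \<open>\<delta> > 0\<close> by (simp add: emeasure_eq_measure2 ennreal_less_iff)
    have "\<exists>d>0. t \<in> {a..b} - N \<longrightarrow>
         (\<forall>y\<in>{a..b}. norm (y-t) < d \<longrightarrow> norm (f y - f t - (y-t) * g t) \<le> e' * norm (y-t))" for t
      using der[of t, unfolded has_real_derivative_iff_has_vector_derivative has_vector_derivative_def has_derivative_within_alt] e'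
      by (auto simp: intro: exI[of _ 1])
    then obtain d where d: "\<And>t. 0 < d t"
        "\<And>t y. \<lbrakk>t \<in> {a..b} - N; y \<in> {a..b}; norm (y-t) < d t\<rbrakk> \<Longrightarrow> norm (f y - f t - (y-t) * g t) \<le> e' * norm (y-t)"
      by metis
    \<comment> \<open>Tags outside \<open>N\<close> are handled as for everywhere differentiable functions; the intervals
      tagged in \<open>N\<close> lie in \<open>U\<close>, so absolute continuity bounds their total contribution.\<close>
    define \<gamma> where "\<gamma> t = (if t \<in> N then U else ball t (d t))" for t
    have gauge: "gauge \<gamma>"
      using U d by (auto simp: gauge_def \<gamma>_def)
    show "\<exists>\<gamma>. gauge \<gamma> \<and> (\<forall>p. p tagged_division_of cbox a b \<and> \<gamma> fine p \<longrightarrow>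
        norm ((\<Sum>(x, k)\<in>p. measure lborel k *\<^sub>R G x) - (f b - f a)) < e)"
    proof (intro exI conjI allI impI, rule gauge, elim conjE)
      fix p assume p: "p tagged_division_of cbox a b" and fine: "\<gamma> fine p"
      have fin: "finite p" using p by blast
      have ba: "b - a = (\<Sum>(x,K)\<in>p. Sup K - Inf K)" "f b - f a = (\<Sum>(x,K)\<in>p. f(Sup K) - f(Inf K))"
        using additive_tagged_division_1[of a b p "\<lambda>x. x"] additive_tagged_division_1[of a b p f]
          ab p by simp_all
      define q where "q = {xk \<in> p. fst xk \<in> N}"
      have qp: "q \<subseteq> p" by (auto simp: q_def)
      have ivl: "\<exists>u v. K = {u..v} \<and> u \<le> t \<and> t \<le> v \<and> a \<le> u \<and> v \<le> b \<and> K \<subseteq> \<gamma> t" if tKp: "(t,K) \<in> p" for t K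
      proof -
        have tK: "t \<in> K" "K \<subseteq> cbox a b" using p that by blast+
        obtain u v :: real where "K = cbox u v" using tagged_division_ofD(4)[OF p tKp] by blast
        with tK have "K = {u..v} \<and> u \<le> t \<and> t \<le> v \<and> a \<le> u \<and> v \<le> b"
          by auto
        moreover have "K \<subseteq> \<gamma> t" using fine that by blast
        ultimately show ?thesis by blast
      qed
      have qpart: "q tagged_partial_division_of cbox a b"
        using p qp tagged_partial_division_subset unfolding tagged_division_of_def by blast
      have qdiv: "snd ` q division_of \<Union>(snd ` q)"
        by (rule partial_division_of_tagged_division[OF qpart])
      have qtag: "q tagged_division_of \<Union>(snd ` q)"
        by (rule tagged_partial_division_of_Union_self[OF qpart])
      have qab: "\<Union>(snd ` q) \<subseteq> {a..b}"
        using ivl qp by fastforce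
      have qU: "\<Union>(snd ` q) \<subseteq> U"
        using fine qp by (fastforce simp: q_def \<gamma>_def fine_def)
      have len: "Sup K - Inf K = measure lebesgue K" if K: "K \<in> snd ` q" for K
      proof -
        from K obtain t where "(t,K) \<in> p" using qp by auto
        from ivl[OF this] show ?thesis by auto
      qed
      have "(\<Sum>K\<in>snd ` q. Sup K - Inf K) = (\<Sum>K\<in>snd ` q. measure lebesgue K)"
        using len by (intro sum.cong) auto
      also have "\<dots> = measure lebesgue (\<Union>(snd ` q))"
        using content_division[OF qdiv] by simp
      also have "\<dots> \<le> measure lebesgue U"
        using qU Um lmeasurable_division[OF qdiv] by (intro measure_mono_fmeasurable) auto
      finally have "(\<Sum>K\<in>snd ` q. \<bar>f (Sup K) - f (Inf K)\<bar>) < e / 2"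
        using Ud \<delta>[OF qdiv qab] by simp
      moreover have "(\<Sum>(x,K)\<in>q. \<bar>f (Sup K) - f (Inf K)\<bar>) = (\<Sum>K\<in>snd ` q. \<bar>f (Sup K) - f (Inf K)\<bar>)"
      proof -
        \<comment> \<open>Two tags can share an interval only if it has empty interior.
          \<open>?d\<close> is set to 0 on all such sets, including the empty set, where
          \<open>Sup\<close> and \<open>Inf\<close> have no meaningful value; on the actual
          intervals of \<open>q\<close> it changes nothing.\<close>
        let ?d = "\<lambda>K. if interior K = {} then 0 else \<bar>f (Sup K) - f (Inf K)\<bar>"
        have eq: "?d K = \<bar>f (Sup K) - f (Inf K)\<bar>" if "K \<in> snd ` q" for K
        proof -
          from that obtain t where "(t,K) \<in> p" using qp by auto
          from ivl[OF this] obtain u v where "K = {u..v}" "u \<le> v" by auto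
          then show ?thesis by (cases "u = v") (auto simp: interior_atLeastAtMost_real)
        qed
        have "(\<Sum>(x,K)\<in>q. ?d K) = (\<Sum>K\<in>snd ` q. ?d K)"
          by (rule sum.over_tagged_division_lemma[OF qtag]) (auto simp: interior_cbox)
        moreover have "(\<Sum>K\<in>snd ` q. ?d K) = (\<Sum>K\<in>snd ` q. \<bar>f (Sup K) - f (Inf K)\<bar>)"
          by (intro sum.cong refl eq)
        moreover have "(\<Sum>(x,K)\<in>q. ?d K) = (\<Sum>(x,K)\<in>q. \<bar>f (Sup K) - f (Inf K)\<bar>)"
          by (intro sum.cong refl) (use eq in force)
        ultimately show ?thesis by simp
      qed
      ultimately have q: "(\<Sum>(x,K)\<in>q. \<bar>f (Sup K) - f (Inf K)\<bar>) < e / 2" by simp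
      have part: "\<bar>measure lborel K * G t - (f (Sup K) - f (Inf K))\<bar>
          \<le> (if t \<in> N then \<bar>f (Sup K) - f (Inf K)\<bar> else e' * (Sup K - Inf K))" if tK: "(t,K) \<in> p" for t K
      proof (cases "t \<in> N")
        case True
        then show ?thesis by (simp add: G_def)
      next
        case False
        obtain u v where K: "K = {u..v}" "u \<le> t" "t \<le> v" "a \<le> u" "v \<le> b" "K \<subseteq> ball t (d t)"
          using ivl[OF tK] False by (auto simp: \<gamma>_def)
        have uv: "u \<in> K" "v \<in> K" using K by auto
        \<comment> \<open>Both end points are compared with the tag, which lies between them, so the
          two errors add up to \<open>e'\<close> times the length of the interval.\<close>
        have "\<bar>f u - f t - (u-t) * g t\<bar> \<le> e' * \<bar>u-t\<bar>" "\<bar>f v - f t - (v-t) * g t\<bar> \<le> e' * \<bar>v-t\<bar>"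
          using d(2)[of t u] d(2)[of t v] False K uv subsetD[OF K(6) uv(1)] subsetD[OF K(6) uv(2)]
          by (auto simp: dist_real_def)
        then have "\<bar>f u - f t - (u-t) * g t\<bar> \<le> e' * (t-u)" "\<bar>f v - f t - (v-t) * g t\<bar> \<le> e' * (v-t)"
          using K by auto
        moreover have "(v - u) * g t - (f v - f u) = (f u - f t - (u-t) * g t) - (f v - f t - (v-t) * g t)"
          by (simp add: algebra_simps)
        ultimately have "\<bar>(v - u) * g t - (f v - f u)\<bar> \<le> e' * (t-u) + e' * (v-t)"
          by linarith
        then show ?thesis using K False by (simp add: G_def algebra_simps)
      qed
      have "\<bar>(\<Sum>(x, k)\<in>p. measure lborel k *\<^sub>R G x) - (f b - f a)\<bar>
          = \<bar>\<Sum>(t,K)\<in>p. measure lborel K * G t - (f (Sup K) - f (Inf K))\<bar>"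
        by (simp add: ba split_def sum_subtractf)
      also have "\<dots> \<le> (\<Sum>(t,K)\<in>p. if t \<in> N then \<bar>f (Sup K) - f (Inf K)\<bar> else e' * (Sup K - Inf K))"
        using part by (intro order.trans[OF sum_abs] sum_mono) auto
      also have "\<dots> \<le> (\<Sum>(t,K)\<in>p. (if t \<in> N then \<bar>f (Sup K) - f (Inf K)\<bar> else 0) + e' * (Sup K - Inf K))"
      proof (intro sum_mono, clarify)
        fix t K assume "(t,K) \<in> p"
        from ivl[OF this] have "0 \<le> e' * (Sup K - Inf K)" using e' by auto
        then show "(if t \<in> N then \<bar>f (Sup K) - f (Inf K)\<bar> else e' * (Sup K - Inf K))
           \<le> (if t \<in> N then \<bar>f (Sup K) - f (Inf K)\<bar> else 0) + e' * (Sup K - Inf K)" by simp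
      qed
      also have "\<dots> = (\<Sum>(t,K)\<in>p. if t \<in> N then \<bar>f (Sup K) - f (Inf K)\<bar> else 0) + e' * (b - a)"
        by (simp add: ba split_def sum.distrib sum_distrib_left)
      also have "(\<Sum>(t,K)\<in>p. if t \<in> N then \<bar>f (Sup K) - f (Inf K)\<bar> else 0) = (\<Sum>(t,K)\<in>q. \<bar>f (Sup K) - f (Inf K)\<bar>)"
        unfolding q_def split_def by (rule sum.inter_filter[symmetric, OF fin])
      also have "e' * (b - a) = e / 2"
        using ab by (simp add: e'_def field_simps)
      finally show "norm ((\<Sum>(x, k)\<in>p. measure lborel k *\<^sub>R G x) - (f b - f a)) < e"
        using q by simp
    qed
  qed
  then show ?thesis
    using has_integral_spike[OF N, of "cbox a b" g G "f b - f a"] by (simp add: G_def)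
qed

lemma abs_continuous_on_imp_continuous_on:
  assumes "abs_continuous_on {a..b} f"
  shows "continuous_on {a..b} f"
proof -
  have "\<exists>\<delta>>0. \<forall>u\<in>{a..b}. \<forall>v\<in>{a..b}. dist v u < \<delta> \<longrightarrow> dist (f v) (f u) < e" if "e > 0" for e
  proof -
    obtain \<delta> where \<delta>: "\<delta> > 0" "\<And>D. D division_of \<Union>D \<Longrightarrow> \<Union>D \<subseteq> {a..b} \<Longrightarrow>
        (\<Sum>k\<in>D. Sup k - Inf k) < \<delta> \<Longrightarrow> (\<Sum>k\<in>D. \<bar>f (Sup k) - f (Inf k)\<bar>) < e"
      using assms \<open>e > 0\<close> unfolding abs_continuous_on_def by meson
    have *: "\<bar>f v - f u\<bar> < e" if "u \<in> {a..b}" "v \<in> {a..b}" "u \<le> v" "v - u < \<delta>" for u v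
    proof -
      have "{{u..v}} division_of \<Union>{{u..v}}"
        using division_of_self[of u v] that by simp
      from \<delta>(2)[OF this] show ?thesis using that by simp
    qed
    show ?thesis
    proof (intro exI conjI ballI impI, rule \<delta>(1))
      fix u v assume "u \<in> {a..b}" "v \<in> {a..b}" "dist v u < \<delta>"
      then show "dist (f v) (f u) < e"
        using *[of u v] *[of v u] by (cases "u \<le> v") (auto simp: dist_real_def abs_minus_commute)
    qed
  qed
  then show ?thesis
    by (intro uniformly_continuous_imp_continuous) (auto simp: uniformly_continuous_on_def)
qed

lemma abs_continuous_on_linear: "abs_continuous_on I (\<lambda>t. c * t + d)"
  unfolding abs_continuous_on_def
proof (intro allI impI)
  fix e :: real assume "e > 0"
  show "\<exists>\<delta>>0. \<forall>D. D division_of \<Union>D \<and> \<Union>D \<subseteq> I \<and> (\<Sum>k\<in>D. Sup k - Inf k) < \<delta>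
        \<longrightarrow> (\<Sum>k\<in>D. \<bar>c * Sup k + d - (c * Inf k + d)\<bar>) < e"
  proof (intro exI[of _ "e / (\<bar>c\<bar> + 1)"] conjI allI impI, goal_cases)
    case 1
    show ?case using \<open>e > 0\<close> by (simp add: add_nonneg_pos)
  next
    case (2 D)
    have "(\<Sum>k\<in>D. \<bar>c * Sup k + d - (c * Inf k + d)\<bar>) = (\<Sum>k\<in>D. \<bar>c\<bar> * (Sup k - Inf k))"
    proof (intro sum.cong refl)
      fix k assume "k \<in> D"
      then obtain u v where "k = {u..v}" "k \<noteq> {}"
        using 2 division_ofD(3,4)[of D "\<Union>D" k] by auto
      then show "\<bar>c * Sup k + d - (c * Inf k + d)\<bar> = \<bar>c\<bar> * (Sup k - Inf k)"
        by (simp add: right_diff_distrib[symmetric] abs_mult)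
    qed
    also have "\<dots> \<le> \<bar>c\<bar> * (e / (\<bar>c\<bar> + 1))"
      unfolding sum_distrib_left[symmetric] using 2 by (intro mult_left_mono) auto
    also have "\<dots> < e" using \<open>e > 0\<close> by (simp add: field_simps add_nonneg_pos)
    finally show ?case .
  qed
qed

lemma abs_continuous_on_mult:
  assumes f: "abs_continuous_on {a..b} f" and g: "abs_continuous_on {a..b} g"
  shows "abs_continuous_on {a..b} (\<lambda>t. f t * g t)"
  unfolding abs_continuous_on_def
proof (intro allI impI)
  fix e :: real assume "e > 0"
  have "bounded (f ` {a..b})" "bounded (g ` {a..b})"
    using f g by (simp_all add: compact_imp_bounded compact_continuous_image abs_continuous_on_imp_continuous_on)
  then obtain A B where A: "A > 0" "\<And>t. t \<in> {a..b} \<Longrightarrow> \<bar>f t\<bar> \<le> A" and B: "B > 0" "\<And>t. t \<in> {a..b} \<Longrightarrow> \<bar>g t\<bar> \<le> B"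
    unfolding bounded_pos by auto
  have "e / (2 * B) > 0" "e / (2 * A) > 0" using A B \<open>e > 0\<close> by auto
  then obtain \<delta> \<delta>' where \<delta>: "\<delta> > 0" "\<And>D. D division_of \<Union>D \<Longrightarrow> \<Union>D \<subseteq> {a..b} \<Longrightarrow>
        (\<Sum>k\<in>D. Sup k - Inf k) < \<delta> \<Longrightarrow> (\<Sum>k\<in>D. \<bar>f (Sup k) - f (Inf k)\<bar>) < e / (2 * B)"
    and \<delta>': "\<delta>' > 0" "\<And>D. D division_of \<Union>D \<Longrightarrow> \<Union>D \<subseteq> {a..b} \<Longrightarrow>
        (\<Sum>k\<in>D. Sup k - Inf k) < \<delta>' \<Longrightarrow> (\<Sum>k\<in>D. \<bar>g (Sup k) - g (Inf k)\<bar>) < e / (2 * A)"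
    using f[unfolded abs_continuous_on_def, rule_format, of "e / (2 * B)"]
      g[unfolded abs_continuous_on_def, rule_format, of "e / (2 * A)"] by (auto simp: Ball_def)
  show "\<exists>\<delta>>0. \<forall>D. D division_of \<Union>D \<and> \<Union>D \<subseteq> {a..b} \<and> (\<Sum>k\<in>D. Sup k - Inf k) < \<delta>
        \<longrightarrow> (\<Sum>k\<in>D. \<bar>f (Sup k) * g (Sup k) - f (Inf k) * g (Inf k)\<bar>) < e"
  proof (intro exI[of _ "min \<delta> \<delta>'"] conjI allI impI, goal_cases)
    case 1
    show ?case using \<delta> \<delta>' by simp
  next
    case (2 D)
    have "(\<Sum>k\<in>D. \<bar>f (Sup k) * g (Sup k) - f (Inf k) * g (Inf k)\<bar>)
       \<le> (\<Sum>k\<in>D. B * \<bar>f (Sup k) - f (Inf k)\<bar> + A * \<bar>g (Sup k) - g (Inf k)\<bar>)"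
    proof (intro sum_mono)
      fix k assume "k \<in> D"
      then obtain u v where uv: "k = {u..v}" "k \<noteq> {}" "k \<subseteq> {a..b}"
        using 2 division_ofD(3,4)[of D "\<Union>D" k] by fastforce
      then have "u \<in> {a..b}" "v \<in> {a..b}" by auto
      have "\<bar>f v * g v - f u * g u\<bar> = \<bar>(f v - f u) * g v + f u * (g v - g u)\<bar>"
        by (simp add: algebra_simps)
      also have "\<dots> \<le> \<bar>f v - f u\<bar> * \<bar>g v\<bar> + \<bar>f u\<bar> * \<bar>g v - g u\<bar>"
        by (metis abs_triangle_ineq abs_mult)
      also have "\<dots> \<le> \<bar>f v - f u\<bar> * B + A * \<bar>g v - g u\<bar>"
        using A(2)[OF \<open>u \<in> {a..b}\<close>] B(2)[OF \<open>v \<in> {a..b}\<close>]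
        by (intro add_mono mult_left_mono mult_right_mono) auto
      finally show "\<bar>f (Sup k) * g (Sup k) - f (Inf k) * g (Inf k)\<bar>
         \<le> B * \<bar>f (Sup k) - f (Inf k)\<bar> + A * \<bar>g (Sup k) - g (Inf k)\<bar>"
        using uv by (simp add: mult.commute)
    qed
    also have "\<dots> = B * (\<Sum>k\<in>D. \<bar>f (Sup k) - f (Inf k)\<bar>) + A * (\<Sum>k\<in>D. \<bar>g (Sup k) - g (Inf k)\<bar>)"
      by (simp add: sum.distrib sum_distrib_left)
    also have "\<dots> < B * (e / (2 * B)) + A * (e / (2 * A))"
      using 2 A(1) B(1) by (intro add_strict_mono mult_strict_left_mono \<delta>(2) \<delta>'(2)) auto
    also have "\<dots> = e" using A(1) B(1) by simp
    finally show ?case .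
  qed
qed

lemma abs_continuous_on_power:
  assumes "abs_continuous_on {a..b} f"
  shows "abs_continuous_on {a..b} (\<lambda>t. f t ^ n)"
proof (induction n)
  case 0
  then show ?case using abs_continuous_on_linear[of _ 0 1] by simp
next
  case (Suc n)
  then show ?case using abs_continuous_on_mult[OF assms Suc] by simp
qed

text \<open>Integration by parts on [0, x], followed by the substitution t = u x; the factor
  \<open>x\<close> on the left is the inner derivative of \<open>f (u * x)\<close>. The weight is 1
  at u = 0 only for \<open>a = 0\<close> and 1 at u = 1 only for \<open>b = 0\<close>, which gives
  the boundary terms. The right-hand side is the continuous counterpart of
  \<open>beta_binomial_summation_by_parts\<close>.\<close>

lemma integral_bernstein_times_deriv:
  fixes f :: "real \<Rightarrow> real"
  assumes x: "0 < x" and reg: "derivative_regular x f"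
    and int1: "(\<lambda>u. u ^ (a - 1) * (1 - u) ^ b * f (u * x)) integrable_on {0..1}"
    and int2: "(\<lambda>u. u ^ a * (1 - u) ^ (b - 1) * f (u * x)) integrable_on {0..1}"
  shows "x * integral {0..1} (\<lambda>u. u ^ a * (1 - u) ^ b * deriv f (u * x)) =
    (if b = 0 then f x else 0) - (if a = 0 then f 0 else 0)
    - real a * integral {0..1} (\<lambda>u. u ^ (a - 1) * (1 - u) ^ b * f (u * x))
    + real b * integral {0..1} (\<lambda>u. u ^ a * (1 - u) ^ (b - 1) * f (u * x))"
proof -
  \<comment> \<open>Regularity speaks of the open interval only, so the end points join the
    exceptional set.\<close>
  let ?N = "{t \<in> {0<..<x}. \<not> f differentiable (at t)} \<union> {0, x}"
  define \<phi> where "\<phi> t = (t / x) ^ a * (1 - t / x) ^ b" for t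
  define \<phi>' where "\<phi>' t = (real a * (t / x) ^ (a - 1) * (1 - t / x) ^ b - real b * (t / x) ^ a * (1 - t / x) ^ (b - 1)) / x" for t
  \<comment> \<open>The bases t/x and 1 - t/x are spelled out in the form \<open>c * t + d\<close>
    of the lemma on linear functions.\<close>
  have "abs_continuous_on {0..x} (\<lambda>t. (1 / x * t + 0) ^ a * (- 1 / x * t + 1) ^ b * f t)"
    using reg unfolding derivative_regular_def
    by (intro abs_continuous_on_mult abs_continuous_on_power abs_continuous_on_linear) auto
  then have ac: "abs_continuous_on {0..x} (\<lambda>t. \<phi> t * f t)"
    by (simp add: \<phi>_def)
  have N: "negligible ?N" using reg by (auto simp: derivative_regular_def intro!: negligible_Un)
  have der: "((\<lambda>t. \<phi> t * f t) has_real_derivative (\<phi>' t * f t + deriv f t * \<phi> t)) (at t within {0..x})"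
    if "t \<in> {0..x} - ?N" for t
  proof (rule has_field_derivative_at_within, rule DERIV_mult)
    have "f field_differentiable (at t)"
      using that by (auto simp: real_differentiable_def field_differentiable_def)
    then show "(f has_real_derivative deriv f t) (at t)"
      by (simp add: DERIV_deriv_iff_field_differentiable)
    show "(\<phi> has_real_derivative \<phi>' t) (at t)"
    proof -
      have "((\<lambda>t. t / x) has_real_derivative 1 / x) (at t)"
        "((\<lambda>t. 1 - t / x) has_real_derivative - (1 / x)) (at t)"
        using x by (auto intro!: derivative_eq_intros)
      from DERIV_mult[OF DERIV_power[OF this(1), of a] DERIV_power[OF this(2), of b]]
      show ?thesis
        unfolding \<phi>_def \<phi>'_def
        by (rule DERIV_cong) (simp add: diff_divide_distrib algebra_simps)
    qed
  qed
  have "((\<lambda>t. \<phi>' t * f t + deriv f t * \<phi> t) has_integral (\<phi> x * f x - \<phi> 0 * f 0)) {0..x}"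
    by (rule abs_continuous_on_has_integral[OF _ ac N der]) (use x in auto)
  moreover have "(\<lambda>t. t / x) ` {0..x} = {0..1}"
    using x by (auto intro!: image_eqI[of _ _ "_ * x"])
  ultimately have tot: "((\<lambda>u. \<phi>' (u * x) * f (u * x) + deriv f (u * x) * \<phi> (u * x)) has_integral ((\<phi> x * f x - \<phi> 0 * f 0) / x)) {0..1}"
    using has_integral_stretch_real[of "\<lambda>t. \<phi>' t * f t + deriv f t * \<phi> t" "\<phi> x * f x - \<phi> 0 * f 0" 0 x x] x
    by (simp add: divide_inverse mult.commute)
  have \<phi>x: "\<phi> (u * x) = u ^ a * (1 - u) ^ b"
    "\<phi>' (u * x) = (real a * (u ^ (a - 1) * (1 - u) ^ b) - real b * (u ^ a * (1 - u) ^ (b - 1))) / x" for u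
    using x by (simp_all add: \<phi>_def \<phi>'_def)
  let ?I1 = "integral {0..1} (\<lambda>u. u ^ (a - 1) * (1 - u) ^ b * f (u * x))"
  let ?I2 = "integral {0..1} (\<lambda>u. u ^ a * (1 - u) ^ (b - 1) * f (u * x))"
  have "((\<lambda>u. (real a * (u ^ (a - 1) * (1 - u) ^ b * f (u * x)) - real b * (u ^ a * (1 - u) ^ (b - 1) * f (u * x))) / x)
     has_integral (real a * ?I1 - real b * ?I2) / x) {0..1}"
    by (intro has_integral_divide has_integral_diff has_integral_mult_right integrable_integral int1 int2)
  \<comment> \<open>Integrability of the term with \<open>deriv f\<close> is obtained here, as the
    total derivative minus two integrable terms.\<close>
  from has_integral_diff[OF tot this]
  have "((\<lambda>u. u ^ a * (1 - u) ^ b * deriv f (u * x)) has_integral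
      ((\<phi> x * f x - \<phi> 0 * f 0) / x - (real a * ?I1 - real b * ?I2) / x)) {0..1}"
    by (rule has_integral_eq[rotated]) (simp add: \<phi>x diff_divide_distrib algebra_simps)
  then have "x * integral {0..1} (\<lambda>u. u ^ a * (1 - u) ^ b * deriv f (u * x)) =
      \<phi> x * f x - \<phi> 0 * f 0 - (real a * ?I1 - real b * ?I2)"
    using x by (simp add: integral_unique diff_divide_distrib[symmetric])
  then show ?thesis using x by (simp add: \<phi>_def power_0_left)
qed

section \<open>Beta-binomial weights\<close>

text \<open>The value is \<open>(h choose k) \<integral> u\<^sup>a\<^sup>+\<^sup>k (1-u)\<^sup>b\<^sup>+\<^sup>h\<^sup>-\<^sup>k du\<close> over \<open>[0, 1]\<close>.\<close>

definition beta_binomial :: "nat \<Rightarrow> nat \<Rightarrow> nat \<Rightarrow> nat \<Rightarrow> real" where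
  "beta_binomial a b h k =
     real (h choose k) * fact (a + k) * fact (b + h - k) / fact (a + b + h + 1)"

lemma fact_add_eq_prod: "fact (k + a) = (fact k * (\<Prod>i<a. real (k + 1 + i)) :: real)"
  by (induction a) (auto simp: algebra_simps)

text \<open>Multiplication by \<open>h + 1\<close> cancels all factorials of growing length. What
  remains is a product of \<open>a + b\<close> ratios, a number independent of \<open>h\<close>, so
  bounds and limits can be taken factor by factor.\<close>

lemma beta_binomial_eq_prod:
  assumes "k \<le> h"
  shows "real (h + 1) * beta_binomial a b h k =
    (\<Prod>i<a. real (k + 1 + i) / real (h + 2 + i)) *
    (\<Prod>i<b. real (h - k + 1 + i) / real (h + 2 + a + i))"
proof -
  have 1: "fact (a + k) = (fact k * (\<Prod>i<a. real (k + 1 + i)) :: real)"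
    using fact_add_eq_prod[of k a] by (simp only: add.commute)
  have 2: "fact (b + h - k) = (fact (h - k) * (\<Prod>i<b. real (h - k + 1 + i)) :: real)"
    using fact_add_eq_prod[of "h - k" b] assms by (simp only: add.commute Nat.add_diff_assoc)
  have 3: "fact (a + b + h + 1) = (fact h * real (h + 1) * (\<Prod>i<a. real (h + 2 + i)) * (\<Prod>i<b. real (h + 2 + a + i)) :: real)"
  proof -
    have "fact (a + b + h + 1) = (fact (h + 1 + a + b) :: real)"
      by (simp only: ac_simps)
    also have "\<dots> = fact (h + 1) * (\<Prod>i<a. real (h + 1 + 1 + i)) * (\<Prod>i<b. real (h + 1 + a + 1 + i))"
      by (simp only: fact_add_eq_prod)
    also have "fact (h + 1) = (fact h * real (h + 1) :: real)" by (simp add: algebra_simps)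
    finally show ?thesis by (simp add: ac_simps)
  qed
  have 4: "real (h choose k) = fact h / (fact k * fact (h - k))"
    using assms by (simp add: binomial_fact)
  have ne: "real (h + 1) \<noteq> 0" by simp
  show ?thesis
    unfolding beta_binomial_def 1 2 3 4 prod_dividef using ne
    by (simp add: field_simps del: of_nat_add of_nat_Suc)
qed

lemma beta_binomial_nonneg: "0 \<le> beta_binomial a b h k"
  by (simp add: beta_binomial_def)

lemma beta_binomial_le:
  assumes "k \<le> h"
  shows "real (h + 1) * beta_binomial a b h k \<le> 1"
  unfolding beta_binomial_eq_prod[OF assms] using assms
  by (intro mult_le_one prod_le_1 prod_nonneg) auto

text \<open>At this index k/h tends to u, so the first \<open>a\<close> ratios of the product form
  tend to u and the other \<open>b\<close> to 1 - u.\<close>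

lemma beta_binomial_tendsto:
  assumes h: "filterlim h at_top sequentially" and u: "0 \<le> u" "u < 1"
  shows "(\<lambda>j. real (h j + 1) * beta_binomial a b (h j) (nat \<lfloor>real (h j + 1) * u\<rfloor>))
    \<longlonglongrightarrow> u ^ a * (1 - u) ^ b"
proof -
  let ?k = "\<lambda>j. nat \<lfloor>real (h j + 1) * u\<rfloor>"
  have k: "?k j \<le> h j" and k': "\<bar>real (?k j) - real (h j + 1) * u\<bar> \<le> 1" for j
  proof -
    have "real (h j + 1) * u < real (h j + 1)" using u by simp
    then show "?k j \<le> h j" by linarith
    have "0 \<le> real (h j + 1) * u" using u by simp
    then show "\<bar>real (?k j) - real (h j + 1) * u\<bar> \<le> 1" by linarith
  qed
  have hr: "filterlim (\<lambda>j. real (h j)) at_top sequentially"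
    by (rule filterlim_compose[OF filterlim_real_sequentially h])
  \<comment> \<open>\<open>d\<close> absorbs the rounding and the constant shifts of the numerator,
    \<open>c\<close> the shift of the denominator; both disappear as \<open>h\<close> grows.\<close>
  have quot: "(\<lambda>j. real (n j) / real (h j + c)) \<longlonglongrightarrow> v"
    if n: "\<And>j. \<bar>real (n j) - real (h j + 1) * v\<bar> \<le> d" for n v c d
  proof (rule Lim_transform)
    have "(\<lambda>j. inverse (real (h j))) \<longlonglongrightarrow> 0"
      by (rule tendsto_inverse_0_at_top[OF hr])
    then have "(\<lambda>j. (1 + inverse (real (h j))) / (1 + real c * inverse (real (h j))) * v) \<longlonglongrightarrow> (1 + 0) / (1 + real c * 0) * v"
      by (intro tendsto_intros) auto
    moreover have "eventually (\<lambda>j. (1 + inverse (real (h j))) / (1 + real c * inverse (real (h j))) * v = real (h j + 1) * v / real (h j + c)) sequentially"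
      using filterlim_at_top_dense[THEN iffD1, OF hr, rule_format, of 0]
    proof eventually_elim
      case (elim j)
      have "1 + inverse (real (h j)) = real (h j + 1) / real (h j)"
        "1 + real c * inverse (real (h j)) = real (h j + c) / real (h j)"
        using elim by (auto simp: field_simps)
      then show ?case using elim by simp
    qed
    ultimately show "(\<lambda>j. real (h j + 1) * v / real (h j + c)) \<longlonglongrightarrow> v"
      using tendsto_cong by force
    have "filterlim (\<lambda>j. real (h j) + real c) at_top sequentially"
      using filterlim_tendsto_add_at_top[OF tendsto_const hr, of "real c"] by (simp add: add.commute)
    then have "(\<lambda>j. d * inverse (real (h j) + real c)) \<longlonglongrightarrow> d * 0"
      by (intro tendsto_intros tendsto_inverse_0_at_top)
    then have lim0: "(\<lambda>j. d / real (h j + c)) \<longlonglongrightarrow> 0"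
      by (simp add: divide_inverse)
    show "(\<lambda>j. real (n j) / real (h j + c) - real (h j + 1) * v / real (h j + c)) \<longlonglongrightarrow> 0"
    proof (rule Lim_null_comparison[OF always_eventually lim0], rule allI)
      fix j
      have "norm (real (n j) / real (h j + c) - real (h j + 1) * v / real (h j + c))
         = \<bar>real (n j) - real (h j + 1) * v\<bar> / real (h j + c)"
        by (simp add: diff_divide_distrib[symmetric])
      also have "\<dots> \<le> d / real (h j + c)"
        by (intro divide_right_mono n) auto
      finally show "norm (real (n j) / real (h j + c) - real (h j + 1) * v / real (h j + c)) \<le> d / real (h j + c)" .
    qed
  qed
  have "(\<lambda>j. (\<Prod>i<a. real (?k j + 1 + i) / real (h j + 2 + i)) *
    (\<Prod>i<b. real (h j - ?k j + 1 + i) / real (h j + 2 + a + i))) \<longlonglongrightarrow> (\<Prod>i<a. u) * (\<Prod>i<b. 1 - u)"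
  proof (intro tendsto_mult tendsto_prod)
    fix i
    have "\<bar>real (?k j + 1 + i) - real (h j + 1) * u\<bar> \<le> 2 + real i" for j
      using k'[of j] unfolding of_nat_add of_nat_1 by linarith
    from quot[OF this, of "2 + i"]
    show "(\<lambda>j. real (?k j + 1 + i) / real (h j + 2 + i)) \<longlonglongrightarrow> u"
      by (simp only: add.assoc)
    have "\<bar>real (h j - ?k j + 1 + i) - real (h j + 1) * (1 - u)\<bar> \<le> 3 + real i" for j
    proof -
      have "real (h j - ?k j) = real (h j) - real (?k j)" using k[of j] by simp
      moreover have "real (h j + 1) * (1 - u) = real (h j) + 1 - real (h j + 1) * u"
        by (simp add: algebra_simps)
      ultimately show ?thesis
        using k'[of j] unfolding of_nat_add of_nat_1 by linarith
    qed
    from quot[OF this, of "2 + a + i"]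
    show "(\<lambda>j. real (h j - ?k j + 1 + i) / real (h j + 2 + a + i)) \<longlonglongrightarrow> 1 - u"
      by (simp only: add.assoc)
  qed
  then show ?thesis
    using k by (simp only: beta_binomial_eq_prod prod_constant card_lessThan)
qed

text \<open>Cutting [0, 1] into \<open>h + 1\<close> equal cells, one for each k from 0 to
  \<open>h\<close>, turns a finite sum into the integral of a step function, to which dominated
  convergence applies.\<close>

lemma has_integral_step:
  fixes \<phi> :: "nat \<Rightarrow> real"
  shows "((\<lambda>u. \<phi> (nat \<lfloor>real (h + 1) * u\<rfloor>)) has_integral (\<Sum>k\<le>h. \<phi> k) / real (h + 1)) {0..1}"
proof -
  have "((\<lambda>u. \<phi> (nat \<lfloor>real (h + 1) * u\<rfloor>)) has_integral (\<Sum>k<n. \<phi> k) / real (h + 1)) {0..real n / real (h + 1)}" for n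
  proof (induction n)
    case 0
    show ?case using has_integral_refl(1)[of "\<lambda>u. \<phi> (nat \<lfloor>real (h + 1) * u\<rfloor>)" "0::real"] by simp
  next
    case (Suc n)
    let ?l = "real n / real (h + 1)" and ?r = "real (Suc n) / real (h + 1)"
    have lr: "?l \<le> ?r" by (intro divide_right_mono) auto
    have "((\<lambda>u. \<phi> n) has_integral (?r - ?l) * \<phi> n) {?l..?r}"
      using has_integral_const_real[of "\<phi> n" ?l ?r] lr by simp
    moreover have "(?r - ?l) * \<phi> n = \<phi> n / real (h + 1)"
      by (simp add: diff_divide_distrib[symmetric])
    \<comment> \<open>At the right end point the floor has already jumped to \<open>n + 1\<close>;
      this single point is discarded.\<close>
    moreover have "\<phi> (nat \<lfloor>real (h + 1) * u\<rfloor>) = \<phi> n" if "u \<in> {?l..?r} - {?r}" for u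
    proof -
      have "real n \<le> real (h + 1) * u" "real (h + 1) * u < real n + 1"
        using that by (auto simp: field_simps)
      then have "\<lfloor>real (h + 1) * u\<rfloor> = int n" by linarith
      then show ?thesis by simp
    qed
    ultimately have "((\<lambda>u. \<phi> (nat \<lfloor>real (h + 1) * u\<rfloor>)) has_integral \<phi> n / real (h + 1)) {?l..?r}"
      using has_integral_spike_finite[of "{?r}" "{?l..?r}" "\<lambda>u. \<phi> (nat \<lfloor>real (h + 1) * u\<rfloor>)" "\<lambda>u. \<phi> n"] by auto
    from has_integral_combine[OF _ lr Suc this] show ?case
      by (simp add: add_divide_distrib)
  qed
  from this[of "h + 1"] show ?thesis by (simp only: lessThan_Suc_atMost Suc_eq_plus1[symmetric]) simp
qed

text \<open>The sum is the integral of a step function with values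
  \<open>(h + 1) * beta_binomial a b h k * m j k\<close>. These are bounded by \<open>B\<close>,
  because the scaled weights are at most 1, and they converge off a null set, so dominated
  convergence yields both the integrability and the limit.\<close>

lemma beta_binomial_sum_tendsto:
  fixes m :: "nat \<Rightarrow> nat \<Rightarrow> real"
  assumes h: "filterlim h at_top sequentially"
    and bound: "\<And>j k. k \<le> h j \<Longrightarrow> \<bar>m j k\<bar> \<le> B"
    and N: "negligible N"
    and lim: "\<And>u. u \<in> {0<..<1} - N \<Longrightarrow> (\<lambda>j. m j (nat \<lfloor>real (h j + 1) * u\<rfloor>)) \<longlonglongrightarrow> F u"
  shows "(\<lambda>u. u ^ a * (1 - u) ^ b * F u) integrable_on {0..1}"
    and "(\<lambda>j. \<Sum>k\<le>h j. beta_binomial a b (h j) k * m j k)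
      \<longlonglongrightarrow> integral {0..1} (\<lambda>u. u ^ a * (1 - u) ^ b * F u)"
proof -
  let ?k = "\<lambda>j u. nat \<lfloor>real (h j + 1) * u\<rfloor>"
  \<comment> \<open>At u = 1 the index would be \<open>h j + 1\<close>, where \<open>m\<close> is
    not controlled, and at u = 0 no limit is assumed. Setting \<open>f\<close> and \<open>g\<close>
    to 0 on \<open>?N\<close> makes bound and convergence hold at every point of [0, 1].\<close>
  let ?N = "N \<union> {0, 1}"
  have N': "negligible ?N" using N by (intro negligible_Un) auto
  define \<phi> where "\<phi> j k = real (h j + 1) * beta_binomial a b (h j) k * m j k" for j k
  define f where "f j u = (if u \<in> ?N then 0 else \<phi> j (?k j u))" for j u
  define g where "g u = (if u \<in> ?N then 0 else u ^ a * (1 - u) ^ b * F u)" for u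
  have fint: "(f j has_integral (\<Sum>k\<le>h j. beta_binomial a b (h j) k * m j k)) {0..1}" for j
  proof -
    have "((\<lambda>u. \<phi> j (?k j u)) has_integral (\<Sum>k\<le>h j. \<phi> j k) / real (h j + 1)) {0..1}"
      by (rule has_integral_step)
    also have "(\<Sum>k\<le>h j. \<phi> j k) / real (h j + 1) = (\<Sum>k\<le>h j. beta_binomial a b (h j) k * m j k)"
      by (simp add: \<phi>_def sum_distrib_left[symmetric] mult.assoc del: of_nat_add of_nat_Suc)
    finally show ?thesis
      by (rule has_integral_spike[OF N', rotated]) (auto simp: f_def)
  qed
  have B: "0 \<le> B" using bound[of 0 0] by (meson abs_ge_zero le0 order_trans)
  have fB: "norm (f j u) \<le> B" if "u \<in> {0..1}" for j u
  proof (cases "u \<in> ?N")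
    case False
    have "real (h j + 1) * u < real (h j + 1)" using that False by simp
    then have k: "?k j u \<le> h j" by linarith
    have "norm (f j u) = (real (h j + 1) * beta_binomial a b (h j) (?k j u)) * \<bar>m j (?k j u)\<bar>"
      using False by (simp add: f_def \<phi>_def abs_mult beta_binomial_nonneg del: of_nat_add of_nat_Suc)
    also have "\<dots> \<le> 1 * B"
      using B by (intro mult_mono beta_binomial_le bound k) auto
    finally show ?thesis by simp
  qed (use B in \<open>auto simp: f_def\<close>)
  have conv: "(\<lambda>j. f j u) \<longlonglongrightarrow> g u" if "u \<in> {0..1}" for u
  proof (cases "u \<in> ?N")
    case False
    then have "(\<lambda>j. (real (h j + 1) * beta_binomial a b (h j) (?k j u)) * m j (?k j u)) \<longlonglongrightarrow> (u ^ a * (1 - u) ^ b) * F u"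
      using that by (intro tendsto_mult beta_binomial_tendsto[OF h] lim) auto
    then show ?thesis using False by (simp add: f_def g_def \<phi>_def)
  qed (simp add: f_def g_def)
  have fint': "f j integrable_on {0..1}" for j using fint by blast
  have gint: "g integrable_on {0..1}" "(\<lambda>j. integral {0..1} (f j)) \<longlonglongrightarrow> integral {0..1} g"
    using dominated_convergence[of f "{0..1}" "\<lambda>_. B" g] fint' fB conv by auto
  have gF: "integral {0..1} g = integral {0..1} (\<lambda>u. u ^ a * (1 - u) ^ b * F u)"
    by (rule integral_spike[OF N']) (auto simp: g_def)
  show "(\<lambda>u. u ^ a * (1 - u) ^ b * F u) integrable_on {0..1}"
    by (rule integrable_spike[OF gint(1) N']) (auto simp: g_def)
  have "(\<lambda>j. integral {0..1} (f j)) = (\<lambda>j. \<Sum>k\<le>h j. beta_binomial a b (h j) k * m j k)"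
    using integral_unique[OF fint] by (rule ext)
  with gint(2) gF show "(\<lambda>j. \<Sum>k\<le>h j. beta_binomial a b (h j) k * m j k)
      \<longlonglongrightarrow> integral {0..1} (\<lambda>u. u ^ a * (1 - u) ^ b * F u)" by simp
qed

text \<open>This is integration by parts of \<open>u\<^sup>a (1-u)\<^sup>b\<close> against the derivative of the Bernstein polynomial
  of degree \<open>h + 1\<close> with coefficients \<open>m\<close>. The truncated \<open>a - 1\<close> and \<open>b - 1\<close> are harmless
  because of the factors \<open>a\<close> and \<open>b\<close>.\<close>

lemma beta_binomial_summation_by_parts:
  fixes m :: "nat \<Rightarrow> real"
  shows "real (h + 1) * (\<Sum>k\<le>h. beta_binomial a b h k * (m (k + 1) - m k)) =
    (if b = 0 then m (h + 1) else 0) - (if a = 0 then m 0 else 0)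
    - real a * (\<Sum>k\<le>h + 1. beta_binomial (a - 1) b (h + 1) k * m k)
    + real b * (\<Sum>k\<le>h + 1. beta_binomial a (b - 1) (h + 1) k * m k)"
proof -
  let ?H = "real (h + 1)"
  \<comment> \<open>The coefficient of \<open>m k\<close> after shifting the index in the first half
    of the sum: the scaled weight at \<open>k - 1\<close> minus the one at \<open>k\<close>, where
    weights outside the range 0 to \<open>h\<close> count as 0.\<close>
  define c where "c k = (if k = 0 then 0 else ?H * beta_binomial a b h (k - 1)) -
      (if k = h + 1 then 0 else ?H * beta_binomial a b h k)" for k
  have "?H * (\<Sum>k\<le>h. beta_binomial a b h k * (m (k + 1) - m k)) =
      (\<Sum>k\<le>h. ?H * beta_binomial a b h k * m (Suc k)) - (\<Sum>k\<le>h. ?H * beta_binomial a b h k * m k)"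
    by (simp add: sum_distrib_left right_diff_distrib sum_subtractf mult.assoc del: of_nat_add)
  also have "(\<Sum>k\<le>h. ?H * beta_binomial a b h k * m (Suc k)) =
      (\<Sum>k\<le>Suc h. (if k = 0 then 0 else ?H * beta_binomial a b h (k - 1)) * m k)"
    by (subst sum.atMost_Suc_shift) simp
  also have "(\<Sum>k\<le>h. ?H * beta_binomial a b h k * m k) =
      (\<Sum>k\<le>Suc h. (if k = h + 1 then 0 else ?H * beta_binomial a b h k) * m k)"
    by simp
  finally have lhs: "?H * (\<Sum>k\<le>h. beta_binomial a b h k * (m (k + 1) - m k)) = (\<Sum>k\<le>h + 1. c k * m k)"
    by (simp add: c_def sum_subtractf left_diff_distrib del: of_nat_add sum.atMost_Suc)
  have c: "c k = (if b = 0 \<and> k = h + 1 then 1 else 0) - (if a = 0 \<and> k = 0 then 1 else 0)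
      - real a * beta_binomial (a - 1) b (h + 1) k + real b * beta_binomial a (b - 1) (h + 1) k"
    if kh: "k \<le> h + 1" for k
  proof -
    \<comment> \<open>For interior \<open>k\<close>, writing \<open>k = Suc i\<close> and
      \<open>h = Suc (i + r)\<close> makes r = h - k and lets the truncated subtractions be
      evaluated.\<close>
    consider "k = 0" | "k = h + 1" | i r where "k = Suc i" "h = Suc (i + r)"
    proof (cases "k = 0 \<or> k = h + 1")
      case False
      then obtain i where i: "k = Suc i" by (cases k) auto
      with kh False have "h = Suc (i + (h - Suc i))" by auto
      with i show ?thesis using that(3) by blast
    qed (use that in auto)
    then show ?thesis
    proof cases
      case 1
      then show ?thesis
        by (cases a; cases b) (simp_all add: c_def beta_binomial_def divide_simps; simp add: algebra_simps)+
    next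
      case 2
      then show ?thesis
        by (cases a; cases b) (simp_all add: c_def beta_binomial_def divide_simps; simp add: algebra_simps)+
    next
      case 3
      define D where "D = (fact (a + b + h + 1) :: real)"
      define P where "P = (fact (a + i) :: real)"
      define Q where "Q = (fact (b + r) :: real)"
      define C where "C = real (h + 1 choose k)"
      have C1: "?H * real (h choose i) = real (Suc i) * C"
      proof -
        have "(h + 1) * (h choose i) = Suc i * (h + 1 choose k)"
          using Suc_times_binomial[of i h] 3(1) by (simp del: binomial_Suc_Suc)
        then show ?thesis unfolding C_def by (metis of_nat_mult)
      qed
      have C2: "?H * real (h choose k) = real (r + 1) * C"
      proof -
        have "h + 1 - k = r + 1" using 3 by simp
        then have "(h + 1) * (h choose k) = (r + 1) * (h + 1 choose k)"
          using binomial_absorb_comp[of "h + 1" k] by (metis add_diff_cancel_right')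
        then show ?thesis unfolding C_def by (metis of_nat_mult)
      qed
      \<comment> \<open>All four terms share the factor C P Q / D. What is left is the identity
        (i+1)(b+r+1) - (r+1)(a+i+1) = b(a+i+1) - a(b+r+1).\<close>
      have "?H * beta_binomial a b h (k - 1) = real (Suc i) * C * (P * (real (b + r + 1) * Q)) / D"
        unfolding beta_binomial_def D_def[symmetric] C1[symmetric] using 3
        by (simp add: P_def Q_def add.commute)
      moreover have "?H * beta_binomial a b h k = real (r + 1) * C * (real (a + i + 1) * P * Q) / D"
        unfolding beta_binomial_def D_def[symmetric] C2[symmetric] using 3
        by (simp add: P_def Q_def add.commute)
      moreover have "real a * beta_binomial (a - 1) b (h + 1) k = real a * C * (P * (real (b + r + 1) * Q)) / D"
        unfolding beta_binomial_def C_def using 3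
        by (cases a) (simp_all add: P_def Q_def D_def add.commute)
      moreover have "real b * beta_binomial a (b - 1) (h + 1) k = real b * C * (real (a + i + 1) * P * Q) / D"
        unfolding beta_binomial_def C_def using 3
        by (cases b) (simp_all add: P_def Q_def D_def add.commute)
      moreover have "c k = ?H * beta_binomial a b h (k - 1) - ?H * beta_binomial a b h k"
        using 3 by (simp add: c_def)
      moreover have "k \<noteq> 0" "k \<noteq> h + 1" using 3 by auto
      ultimately show ?thesis
        by (simp add: diff_divide_distrib[symmetric] add_divide_distrib[symmetric]) (simp add: algebra_simps)
    qed
  qed
  have "(\<Sum>k\<le>h + 1. c k * m k) = (\<Sum>k\<le>h + 1. (if b = 0 \<and> k = h + 1 then m k else 0) - (if a = 0 \<and> k = 0 then m k else 0)
      - real a * (beta_binomial (a - 1) b (h + 1) k * m k) + real b * (beta_binomial a (b - 1) (h + 1) k * m k))"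
    by (intro sum.cong) (auto simp: c algebra_simps)
  also have "\<dots> = (if b = 0 then m (h + 1) else 0) - (if a = 0 then m 0 else 0)
    - real a * (\<Sum>k\<le>h + 1. beta_binomial (a - 1) b (h + 1) k * m k)
    + real b * (\<Sum>k\<le>h + 1. beta_binomial a (b - 1) (h + 1) k * m k)"
    by (simp add: sum.distrib sum_subtractf sum_distrib_left[symmetric] del: sum.atMost_Suc)
  finally show ?thesis using lhs by simp
qed

section \<open>Cost-minimal allocations\<close>

text \<open>The discrete analogue of \<open>M_Omega\<close>, with whole peers out of
  \<open>n\<close>. Extensional functions with values at most \<open>k\<close> form a finite set,
  which makes \<open>Min\<close> meaningful.\<close>

definition alloc_min :: "('a \<Rightarrow> real \<Rightarrow> real) \<Rightarrow> nat \<Rightarrow> 'a set \<Rightarrow> nat \<Rightarrow> real" where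
  "alloc_min W n S k =
     Min ((\<lambda>c. \<Sum>i\<in>S. W i (real (c i) / real n)) ` {c \<in> S \<rightarrow>\<^sub>E {..k}. sum c S \<le> k})"

lemma alloc_min_le:
  assumes "finite S" "sum c S \<le> k"
  shows "alloc_min W n S k \<le> (\<Sum>i\<in>S. W i (real (c i) / real n))"
  unfolding alloc_min_def
proof (rule Min_le)
  show "finite ((\<lambda>c. \<Sum>i\<in>S. W i (real (c i) / real n)) ` {c \<in> S \<rightarrow>\<^sub>E {..k}. sum c S \<le> k})"
    using assms by (intro finite_imageI finite_subset[OF _ finite_PiE[of S "\<lambda>_. {..k}"]]) auto
  have "c i \<le> k" if "i \<in> S" for i
    using member_le_sum[of i S c] assms that by simp
  then show "(\<Sum>i\<in>S. W i (real (c i) / real n)) \<in>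
      (\<lambda>c. \<Sum>i\<in>S. W i (real (c i) / real n)) ` {c \<in> S \<rightarrow>\<^sub>E {..k}. sum c S \<le> k}"
    using assms by (intro image_eqI[of _ _ "restrict c S"]) auto
qed

lemma alloc_min_attained:
  assumes "finite S"
  obtains c where "sum c S \<le> k" "\<And>i. i \<in> S \<Longrightarrow> c i \<le> k"
    "alloc_min W n S k = (\<Sum>i\<in>S. W i (real (c i) / real n))"
proof -
  let ?A = "{c \<in> S \<rightarrow>\<^sub>E {..k}. sum c S \<le> k}"
  have "finite ?A"
    using assms by (intro finite_subset[OF _ finite_PiE[of S "\<lambda>_. {..k}"]]) auto
  moreover have "restrict (\<lambda>_. 0) S \<in> ?A" by auto
  then have "?A \<noteq> {}" by blast
  ultimately have "alloc_min W n S k \<in> (\<lambda>c. \<Sum>i\<in>S. W i (real (c i) / real n)) ` ?A"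
    unfolding alloc_min_def by (intro Min_in) auto
  with that show ?thesis by (auto simp: PiE_def Pi_def)
qed

lemma alloc_min_empty [simp]: "alloc_min W n {} k = 0"
  using alloc_min_attained[of "{}" k W n] by force

lemma alloc_min_0: 
  assumes "finite S"
  shows "alloc_min W n S 0 = (\<Sum>i\<in>S. W i 0)"
  by (rule alloc_min_attained[OF assms, of 0 W n]) simp

text \<open>Only the arguments c/n with c \<le> k are ever sampled, so the costs need to agree only
  there. This permits rescaling the costs and cutting them off beyond the available fraction in one
  go.\<close>

lemma alloc_min_divide:
  assumes "finite S" "r > 0"
    and "\<And>i c. i \<in> S \<Longrightarrow> c \<le> k \<Longrightarrow> V i (real c / real n) = W i (real c / real n) / r"
  shows "alloc_min V n S k = alloc_min W n S k / r"
proof (rule antisym)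
  obtain c where c: "sum c S \<le> k" "\<And>i. i \<in> S \<Longrightarrow> c i \<le> k"
    "alloc_min W n S k = (\<Sum>i\<in>S. W i (real (c i) / real n))"
    using alloc_min_attained[OF assms(1), of k W n] by blast
  have "alloc_min V n S k \<le> (\<Sum>i\<in>S. V i (real (c i) / real n))"
    by (rule alloc_min_le[OF assms(1) c(1)])
  then show "alloc_min V n S k \<le> alloc_min W n S k / r"
    by (simp add: c assms(3) sum_divide_distrib)
  obtain c where c: "sum c S \<le> k" "\<And>i. i \<in> S \<Longrightarrow> c i \<le> k"
    "alloc_min V n S k = (\<Sum>i\<in>S. V i (real (c i) / real n))"
    using alloc_min_attained[OF assms(1), of k V n] by blast
  have "alloc_min W n S k \<le> (\<Sum>i\<in>S. W i (real (c i) / real n))"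
    by (rule alloc_min_le[OF assms(1) c(1)])
  then have "alloc_min W n S k / r \<le> (\<Sum>i\<in>S. W i (real (c i) / real n)) / r"
    using assms(2) by (simp add: divide_right_mono)
  then show "alloc_min W n S k / r \<le> alloc_min V n S k"
    by (simp add: c assms(3) sum_divide_distrib)
qed

lemma alloc_min_nonneg:
  assumes "finite S" "\<And>i c. i \<in> S \<Longrightarrow> c \<le> k \<Longrightarrow> 0 \<le> W i (real c / real n)"
  shows "0 \<le> alloc_min W n S k"
  by (rule alloc_min_attained[OF assms(1), of k W n]) (simp add: assms(2) sum_nonneg)

section \<open>The fluid minimum and its approximation by integer allocations\<close>

lemma M_Omega_empty [simp]: "M_Omega W {} x = 0"
  by (simp add: M_Omega_def)

lemma M_Omega_le:
  assumes "finite S" "\<And>i t. i \<in> S \<Longrightarrow> 0 \<le> t \<Longrightarrow> 0 \<le> W i t"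
    and "\<And>i. i \<in> S \<Longrightarrow> 0 \<le> y i" "(\<Sum>i\<in>S. y i) \<le> x"
  shows "M_Omega W S x \<le> (\<Sum>i\<in>S. W i (y i))"
proof (cases "S = {}")
  case False
  have "bdd_below ((\<lambda>y. \<Sum>i\<in>S. W i (y i)) ` {y. (\<forall>i\<in>S. 0 \<le> y i) \<and> (\<Sum>i\<in>S. y i) \<le> x})"
    by (rule bdd_belowI[of _ 0]) (auto intro!: sum_nonneg assms(2))
  then show ?thesis
    using False assms(3,4) unfolding M_Omega_def by (auto intro!: cINF_lower2[where x = y])
qed simp

lemma M_Omega_greatest:
  assumes "0 \<le> x" "\<And>y. (\<And>i. i \<in> S \<Longrightarrow> 0 \<le> y i) \<Longrightarrow> (\<Sum>i\<in>S. y i) \<le> x \<Longrightarrow> B \<le> (\<Sum>i\<in>S. W i (y i))"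
  shows "B \<le> M_Omega W S x"
proof (cases "S = {}")
  case True
  then show ?thesis using assms(2)[of "\<lambda>_. 0"] assms(1) by simp
next
  case False
  have "(\<lambda>_. 0) \<in> {y. (\<forall>i\<in>S. 0 \<le> y i) \<and> (\<Sum>i\<in>S. y i) \<le> x}" using assms(1) by simp
  then show ?thesis
    using False assms(2) unfolding M_Omega_def by (auto intro!: cINF_greatest)
qed

lemma M_Omega_approx:
  assumes "0 \<le> x" "M_Omega W S x < B"
  obtains y where "\<And>i. i \<in> S \<Longrightarrow> 0 \<le> y i" "(\<Sum>i\<in>S. y i) \<le> x" "(\<Sum>i\<in>S. W i (y i)) < B"
proof (rule ccontr)
  assume "\<not> thesis"
  have "B \<le> M_Omega W S x"
  proof (rule M_Omega_greatest[OF assms(1)], rule ccontr)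
    fix y assume y: "\<And>i. i \<in> S \<Longrightarrow> 0 \<le> y i" "(\<Sum>i\<in>S. y i) \<le> x"
      and "\<not> B \<le> (\<Sum>i\<in>S. W i (y i))"
    then show False using that[OF y] \<open>\<not> thesis\<close> by auto
  qed
  with assms(2) show False by simp
qed

lemma M_Omega_antimono:
  assumes "finite S" "\<And>i t. i \<in> S \<Longrightarrow> 0 \<le> t \<Longrightarrow> 0 \<le> W i t" "0 \<le> x" "x \<le> x'"
  shows "M_Omega W S x' \<le> M_Omega W S x"
  using assms(4) by (intro M_Omega_greatest[OF assms(3)] M_Omega_le[OF assms(1,2)]) auto

lemma M_Omega_0:
  assumes "finite S"
  shows "M_Omega W S 0 = (\<Sum>i\<in>S. W i 0)"
proof (cases "S = {}")
  case False
  let ?Y = "{y. (\<forall>i\<in>S. 0 \<le> y i) \<and> (\<Sum>i\<in>S. y i) \<le> (0::real)}"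
  have "(\<Sum>i\<in>S. W i (y i)) = (\<Sum>i\<in>S. W i 0)" if "y \<in> ?Y" for y
  proof -
    have "\<forall>i\<in>S. y i = 0"
      using that sum_nonneg_eq_0_iff[OF assms, of y] sum_nonneg[of S y] by force
    then show ?thesis by simp
  qed
  then have "(INF y\<in>?Y. \<Sum>i\<in>S. W i (y i)) = (INF y\<in>?Y. \<Sum>i\<in>S. W i 0)"
    by (intro INF_cong refl)
  also have "\<dots> = (\<Sum>i\<in>S. W i 0)"
  proof (rule cINF_const)
    have "(\<lambda>_. 0) \<in> ?Y" by simp
    then show "?Y \<noteq> {}" by blast
  qed
  finally show ?thesis using False by (simp add: M_Omega_def)
qed simp

lemma M_Omega_cong:
  assumes "\<And>i t. i \<in> S \<Longrightarrow> 0 \<le> t \<Longrightarrow> t \<le> x \<Longrightarrow> V i t = W i t" "finite S"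
  shows "M_Omega V S x = M_Omega W S x"
proof -
  have "(\<Sum>i\<in>S. V i (y i)) = (\<Sum>i\<in>S. W i (y i))" if "\<forall>i\<in>S. 0 \<le> y i" "(\<Sum>i\<in>S. y i) \<le> x" for y
    using that member_le_sum[of _ S y] assms by (intro sum.cong) (auto intro!: assms(1) intro: order_trans)
  then show ?thesis
    unfolding M_Omega_def by (auto intro!: INF_cong)
qed

lemma countable_M_Omega_discontinuities:
  assumes "finite S" "\<And>i t. i \<in> S \<Longrightarrow> 0 \<le> t \<Longrightarrow> 0 \<le> W i t"
  shows "countable {y. 0 < y \<and> \<not> isCont (M_Omega W S) y}"
proof -
  have "mono_on {0<..} (\<lambda>y. - M_Omega W S y)"
    by (intro mono_onI) (auto intro!: M_Omega_antimono assms)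
  then have "countable {y \<in> {0<..}. \<not> isCont (\<lambda>y. - M_Omega W S y) y}"
    by (intro mono_on_ctble_discont_open) auto
  moreover have "isCont (\<lambda>y. - M_Omega W S y) y \<longleftrightarrow> isCont (M_Omega W S) y" for y
    using continuous_minus[of "at y" "\<lambda>y. - M_Omega W S y"] continuous_minus[of "at y" "M_Omega W S"] by auto
  ultimately show ?thesis by (auto simp: Collect_conj_eq)
qed

text \<open>An allocation of x' becomes one of a smaller x by lowering every component by r = x' - x
  and truncating at 0. If some component is at least r, the total drops by at least r; otherwise
  everything becomes 0. No component moves by more than r, so a common modulus of continuity bounds
  the extra cost; monotonicity gives the other inequality.\<close>

lemma continuous_on_M_Omega:
  assumes fin: "finite S" and nonneg: "\<And>i t. i \<in> S \<Longrightarrow> 0 \<le> t \<Longrightarrow> 0 \<le> W i t"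
    and uc: "\<And>i. i \<in> S \<Longrightarrow> uniformly_continuous_on UNIV (W i)"
  shows "continuous_on {0..} (M_Omega W S)"
proof -
  have "\<exists>\<delta>>0. \<forall>x\<ge>0. \<forall>x'. x \<le> x' \<longrightarrow> x' < x + \<delta> \<longrightarrow> M_Omega W S x \<le> M_Omega W S x' + e" if "e > 0" for e
  proof -
    define e' where "e' = e / (real (card S) + 1)"
    have "e' > 0" using that by (simp add: e'_def add_nonneg_pos)
    then have "\<forall>i\<in>S. \<exists>\<delta>>0. \<forall>t s. \<bar>t - s\<bar> < \<delta> \<longrightarrow> \<bar>W i t - W i s\<bar> < e'"
      using uc unfolding uniformly_continuous_on_def dist_real_def by (metis UNIV_I)
    then obtain \<delta> where \<delta>: "\<And>i. i \<in> S \<Longrightarrow> \<delta> i > 0"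
        "\<And>i t s. i \<in> S \<Longrightarrow> \<bar>t - s\<bar> < \<delta> i \<Longrightarrow> \<bar>W i t - W i s\<bar> < e'" by metis
    define d where "d = Min (insert 1 (\<delta> ` S))"
    have d: "d > 0" "\<And>i. i \<in> S \<Longrightarrow> d \<le> \<delta> i"
      using fin \<delta>(1) by (auto simp: d_def)
    have "M_Omega W S x \<le> M_Omega W S x' + e" if x: "0 \<le> x" "x \<le> x'" "x' < x + d" for x x'
    proof -
      have "M_Omega W S x - e \<le> M_Omega W S x'"
      proof (rule M_Omega_greatest)
        fix y assume y: "\<And>i. i \<in> S \<Longrightarrow> 0 \<le> y i" "(\<Sum>i\<in>S. y i) \<le> x'"
        define r where "r = x' - x"
        have r: "0 \<le> r" "r < d" using x by (auto simp: r_def)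
        define z where "z i = max 0 (y i - r)" for i
        have "(\<Sum>i\<in>S. z i) \<le> x"
        proof (cases "\<exists>i\<in>S. r \<le> y i")
          case True
          then obtain i where i: "i \<in> S" "r \<le> y i" by blast
          have "(\<Sum>i\<in>S. z i) = z i + sum z (S - {i})"
            by (rule sum.remove[OF fin i(1)])
          also have "\<dots> \<le> (y i - r) + sum y (S - {i})"
            using i y(1) r by (intro add_mono sum_mono) (auto simp: z_def)
          also have "\<dots> = sum y S - r"
            by (simp add: sum.remove[OF fin i(1), of y])
          finally show ?thesis using y(2) by (simp add: r_def)
        next
          case False
          then have "(\<Sum>i\<in>S. z i) = 0" by (intro sum.neutral) (auto simp: z_def)
          then show ?thesis using x by simp
        qed
        then have "M_Omega W S x \<le> (\<Sum>i\<in>S. W i (z i))"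
          by (intro M_Omega_le fin nonneg) (auto simp: z_def)
        also have "\<dots> \<le> (\<Sum>i\<in>S. W i (y i) + e')"
        proof (intro sum_mono)
          fix i assume i: "i \<in> S"
          have "\<bar>z i - y i\<bar> < \<delta> i" using y(1)[OF i] r d(2)[OF i] by (auto simp: z_def)
          from \<delta>(2)[OF i this] show "W i (z i) \<le> W i (y i) + e'" by linarith
        qed
        also have "\<dots> = (\<Sum>i\<in>S. W i (y i)) + real (card S) * e'"
          by (simp add: sum.distrib)
        also have "real (card S) * e' \<le> e"
          using \<open>e > 0\<close> by (simp add: e'_def field_simps)
        finally show "M_Omega W S x - e \<le> (\<Sum>i\<in>S. W i (y i))" by simp
      qed (use x in auto)
      then show ?thesis by simp
    qed
    then show ?thesis using d(1) by blast
  qed note key = this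
  have "\<exists>\<delta>>0. \<forall>x\<in>{0..}. \<forall>x'\<in>{0..}. dist x' x < \<delta> \<longrightarrow> dist (M_Omega W S x') (M_Omega W S x) < e" if "e > 0" for e
  proof -
    from key[of "e/2"] that obtain \<delta> where \<delta>: "\<delta> > 0"
      "\<And>x x'. 0 \<le> x \<Longrightarrow> x \<le> x' \<Longrightarrow> x' < x + \<delta> \<Longrightarrow> M_Omega W S x \<le> M_Omega W S x' + e/2" by auto
    have *: "\<bar>M_Omega W S x' - M_Omega W S x\<bar> < e" if "0 \<le> x" "x \<le> x'" "x' < x + \<delta>" for x x'
      using \<delta>(2)[OF that] M_Omega_antimono[OF fin nonneg that(1,2)] \<open>e > 0\<close> by simp
    show ?thesis
    proof (intro exI conjI ballI impI, rule \<delta>(1))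
      fix x x' :: real assume "x \<in> {0..}" "x' \<in> {0..}" "dist x' x < \<delta>"
      then show "dist (M_Omega W S x') (M_Omega W S x) < e"
        using *[of x x'] *[of x' x] by (cases "x \<le> x'") (auto simp: dist_real_def abs_minus_commute)
    qed
  qed
  then show ?thesis
    by (intro uniformly_continuous_imp_continuous) (auto simp: uniformly_continuous_on_def)
qed

text \<open>For the upper bound, an almost optimal real allocation of slightly less than
  \<open>y\<close> is rounded up to whole peers. For the lower bound the optimal integer allocation
  varies with j, while the costs converge only pointwise. It is therefore rounded up to a fixed
  grid, where finitely many points make the convergence uniform. Rounding up never raises a
  nonincreasing cost, and continuity at \<open>y\<close> pays for the change in the total.\<close>

lemma alloc_min_tendsto_M_Omega:
  fixes G :: "'a \<Rightarrow> nat \<Rightarrow> real \<Rightarrow> real" and Gt :: "'a \<Rightarrow> real \<Rightarrow> real"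
  assumes fin: "finite S"
    and nonneg: "\<And>i t. i \<in> S \<Longrightarrow> 0 \<le> t \<Longrightarrow> 0 \<le> Gt i t"
    and anti: "\<And>i j. i \<in> S \<Longrightarrow> antimono (G i j)"
    and lim: "\<And>i t. i \<in> S \<Longrightarrow> (\<lambda>j. G i j t) \<longlonglongrightarrow> Gt i t"
    and n: "filterlim n at_top sequentially"
    and k: "(\<lambda>j. real (k j) / real (n j)) \<longlonglongrightarrow> y" and y: "0 < y"
    and cont: "isCont (M_Omega Gt S) y"
  shows "(\<lambda>j. alloc_min (\<lambda>i. G i j) (n j) S (k j)) \<longlonglongrightarrow> M_Omega Gt S y"
proof -
  let ?M = "M_Omega Gt S"
  have nr: "filterlim (\<lambda>j. real (n j)) at_top sequentially"
    by (rule filterlim_compose[OF filterlim_real_sequentially n])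
  have npos: "eventually (\<lambda>j. 0 < real (n j)) sequentially"
    using filterlim_at_top_dense[THEN iffD1, OF nr] by blast
  have close: "\<exists>\<delta>>0. \<delta> < y \<and> (\<forall>z. \<bar>z - y\<bar> \<le> \<delta> \<longrightarrow> \<bar>?M z - ?M y\<bar> < e)" if "e > 0" for e
  proof -
    obtain \<delta> where "\<delta> > 0" "\<And>z. \<bar>z - y\<bar> < \<delta> \<Longrightarrow> \<bar>?M z - ?M y\<bar> < e"
      using cont \<open>e > 0\<close> unfolding continuous_at_eps_delta dist_real_def by blast
    then show ?thesis using y by (intro exI[of _ "min (\<delta>/2) (y/2)"]) auto
  qed
  show ?thesis
  proof (rule order_tendstoI)
    fix B assume "?M y < B"
    then obtain \<delta> where \<delta>: "\<delta> > 0" "\<delta> < y" "\<bar>?M (y - \<delta>) - ?M y\<bar> < B - ?M y"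
      using close[of "B - ?M y"] by force
    then have "?M (y - \<delta>) < B" by simp
    then obtain a where a: "\<And>i. i \<in> S \<Longrightarrow> 0 \<le> a i" "(\<Sum>i\<in>S. a i) \<le> y - \<delta>" "(\<Sum>i\<in>S. Gt i (a i)) < B"
      using M_Omega_approx[of "y - \<delta>" Gt S B] \<delta> by force
    have "(\<lambda>j. \<Sum>i\<in>S. G i j (a i)) \<longlonglongrightarrow> (\<Sum>i\<in>S. Gt i (a i))"
      by (intro tendsto_sum lim)
    from order_tendstoD(2)[OF this a(3)] have ev1: "eventually (\<lambda>j. (\<Sum>i\<in>S. G i j (a i)) < B) sequentially" .
    have ev2: "eventually (\<lambda>j. y - \<delta>/2 < real (k j) / real (n j)) sequentially"
      using order_tendstoD(1)[OF k, of "y - \<delta>/2"] \<delta> by simp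
    have ev3: "eventually (\<lambda>j. real (card S) / (\<delta>/2) < real (n j)) sequentially"
      using filterlim_at_top_dense[THEN iffD1, OF nr] by blast
    show "eventually (\<lambda>j. alloc_min (\<lambda>i. G i j) (n j) S (k j) < B) sequentially"
      using ev1 ev2 ev3 npos
    proof eventually_elim
      case (elim j)
      \<comment> \<open>Rounding up adds at most one peer per provider; the slack of
        \<open>n j * (\<delta>/2)\<close> peers covers all of them once \<open>n j\<close> is
        large.\<close>
      define c where "c i = nat \<lceil>real (n j) * a i\<rceil>" for i
      have c: "real (n j) * a i \<le> real (c i)" "real (c i) \<le> real (n j) * a i + 1" if "i \<in> S" for i
      proof -
        have "0 \<le> real (n j) * a i" using a(1)[OF that] by simp
        then show "real (n j) * a i \<le> real (c i)" "real (c i) \<le> real (n j) * a i + 1"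
          unfolding c_def by linarith+
      qed
      have "real (sum c S) \<le> (\<Sum>i\<in>S. real (n j) * a i + 1)"
        unfolding of_nat_sum by (intro sum_mono c)
      also have "\<dots> = real (n j) * (\<Sum>i\<in>S. a i) + real (card S)"
        by (simp add: sum.distrib sum_distrib_left)
      also have "\<dots> \<le> real (n j) * (y - \<delta>) + real (n j) * (\<delta>/2)"
        using a(2) elim(3) \<delta>(1) by (intro add_mono mult_left_mono) (auto simp: field_simps)
      also have "\<dots> = real (n j) * (y - \<delta>/2)" by (simp add: algebra_simps)
      also have "\<dots> \<le> real (k j)" using elim by (simp add: field_simps)
      finally have "sum c S \<le> k j" by linarith
      from alloc_min_le[OF fin this]
      have "alloc_min (\<lambda>i. G i j) (n j) S (k j) \<le> (\<Sum>i\<in>S. G i j (real (c i) / real (n j)))" .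
      also have "\<dots> \<le> (\<Sum>i\<in>S. G i j (a i))"
        using c(1) elim(4) by (intro sum_mono antimonoD[OF anti]) (auto simp: field_simps)
      also have "\<dots> < B" by (rule elim(1))
      finally show ?case .
    qed
  next
    fix B assume "B < ?M y"
    then obtain \<delta> where \<delta>: "\<delta> > 0" "\<delta> < y" "\<bar>?M (y + \<delta>) - ?M y\<bar> < (?M y - B) / 2"
      using close[of "(?M y - B) / 2"] by force
    \<comment> \<open>The mesh is so small that rounding all components up raises the total by at
      most \<delta>/2. The other \<delta>/2 allows for k/n exceeding \<open>y\<close>. The summand 1
      covers empty \<open>S\<close>.\<close>
    define r where "r = \<delta> / (2 * (real (card S) + 1))"
    have r: "r > 0" "real (card S) * r \<le> \<delta> / 2"
      using \<delta>(1) by (auto simp: r_def field_simps add_nonneg_pos)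
    \<comment> \<open>No component exceeds y + \<delta>, so grid indices up to \<open>N\<close>
      suffice.\<close>
    define N where "N = nat \<lceil>(y + \<delta>) / r\<rceil>"
    \<comment> \<open>Half of the gap between \<open>B\<close> and \<open>?M y\<close> is lost by
      passing to y + \<delta>; the errors \<open>e\<close> at the grid points together stay below
      the other half.\<close>
    define e where "e = (?M y - B) / (2 * (real (card S) + 1))"
    have e: "e > 0" "real (card S) * e < (?M y - B) / 2"
      using \<open>B < ?M y\<close> by (auto simp: e_def field_simps add_nonneg_pos)
    have "eventually (\<lambda>j. \<forall>i\<in>S. \<forall>l\<in>{..N}. Gt i (r * real l) - e < G i j (r * real l)) sequentially"
      using fin e(1) order_tendstoD(1)[OF lim] by (intro eventually_ball_finite ballI) auto
    moreover have "eventually (\<lambda>j. real (k j) / real (n j) < y + \<delta>/2) sequentially"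
      using order_tendstoD(2)[OF k, of "y + \<delta>/2"] \<delta> by simp
    ultimately show "eventually (\<lambda>j. B < alloc_min (\<lambda>i. G i j) (n j) S (k j)) sequentially"
      using npos
    proof eventually_elim
      case (elim j)
      obtain c where c: "sum c S \<le> k j" "\<And>i. i \<in> S \<Longrightarrow> c i \<le> k j"
        "alloc_min (\<lambda>i. G i j) (n j) S (k j) = (\<Sum>i\<in>S. G i j (real (c i) / real (n j)))"
        using alloc_min_attained[OF fin, of "k j" "\<lambda>i. G i j" "n j"] by blast
      define l where "l i = nat \<lceil>real (c i) / real (n j) / r\<rceil>" for i
      have l: "real (c i) / real (n j) \<le> r * real (l i)" "r * real (l i) \<le> real (c i) / real (n j) + r" for i
      proof -
        have gen: "q \<le> r * v \<and> r * v \<le> q + r" if "q / r \<le> v" "v \<le> q / r + 1" for q v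
          using r(1) that by (auto simp: field_simps)
        have "0 \<le> real (c i) / real (n j) / r" using r by simp
        then have "real (c i) / real (n j) / r \<le> real (l i)" "real (l i) \<le> real (c i) / real (n j) / r + 1"
          unfolding l_def by linarith+
        then show "real (c i) / real (n j) \<le> r * real (l i)" "r * real (l i) \<le> real (c i) / real (n j) + r"
          using gen by blast+
      qed
      have lN: "l i \<le> N" if "i \<in> S" for i
      proof -
        have "real (c i) / real (n j) \<le> real (k j) / real (n j)"
          using c(2)[OF that] by (simp add: divide_right_mono)
        also have "\<dots> \<le> y + \<delta>" using elim(2) \<delta> by simp
        finally have "real (c i) / real (n j) / r \<le> (y + \<delta>) / r"
          by (intro divide_right_mono) (use r in auto)
        then show ?thesis unfolding l_def N_def by (intro nat_mono ceiling_mono)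
      qed
      have "(\<Sum>i\<in>S. r * real (l i)) \<le> (\<Sum>i\<in>S. real (c i) / real (n j) + r)"
        by (intro sum_mono l)
      also have "\<dots> = real (sum c S) / real (n j) + real (card S) * r"
        by (simp add: sum.distrib sum_divide_distrib)
      also have "\<dots> \<le> real (k j) / real (n j) + \<delta> / 2"
        using c(1) r(2) by (intro add_mono divide_right_mono of_nat_mono) auto
      also have "\<dots> \<le> y + \<delta>" using elim(2) by simp
      finally have "?M (y + \<delta>) \<le> (\<Sum>i\<in>S. Gt i (r * real (l i)))"
        using r(1) by (intro M_Omega_le fin nonneg) auto
      also have "\<dots> \<le> (\<Sum>i\<in>S. G i j (r * real (l i)) + e)"
        using elim(1) lN by (intro sum_mono) (force simp: algebra_simps)
      also have "\<dots> = (\<Sum>i\<in>S. G i j (r * real (l i))) + real (card S) * e"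
        by (simp add: sum.distrib)
      finally have "?M (y + \<delta>) \<le> (\<Sum>i\<in>S. G i j (r * real (l i))) + real (card S) * e" .
      moreover have "(\<Sum>i\<in>S. G i j (r * real (l i))) \<le> (\<Sum>i\<in>S. G i j (real (c i) / real (n j)))"
        by (intro sum_mono antimonoD[OF anti] l)
      moreover have "?M y - ?M (y + \<delta>) < (?M y - B) / 2" using \<delta>(3) by linarith
      moreover have "B < w" if "m' \<le> v + d" "v \<le> w" "m - m' < (m - B) / 2" "d < (m - B) / 2" for m m' v w d :: real
        using that by (simp add: field_simps)
      ultimately show ?case unfolding c(3) using e(2) by blast
    qed
  qed
qed

section \<open>Worth and Shapley value\<close>

text \<open>Greedy choice: reserve \<open>c a\<close> elements for \<open>a\<close>, then serve the
  remaining targets from the rest. Surplus elements also have to go somewhere, hence at least one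
  target.\<close>

lemma exists_assignment:
  assumes "finite A" "A \<noteq> {}" "finite K" "sum c A \<le> card K"
  shows "\<exists>f. f \<in> K \<rightarrow> A \<and> (\<forall>i\<in>A. c i \<le> card {h \<in> K. f h = i})"
  using assms
proof (induction A arbitrary: K rule: finite_ne_induct)
  case (singleton a)
  then show ?case by (intro exI[of _ "\<lambda>_. a"]) auto
next
  case (insert a A)
  then have "c a \<le> card K" by simp
  then obtain L where L: "L \<subseteq> K" "card L = c a"
    by (rule obtain_subset_with_card_n)
  have "sum c A \<le> card (K - L)"
    using insert L by (simp add: card_Diff_subset finite_subset)
  with insert obtain f where f: "f \<in> K - L \<rightarrow> A" "\<forall>i\<in>A. c i \<le> card {h \<in> K - L. f h = i}"
    by blast
  define g where "g h = (if h \<in> L then a else f h)" for h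
  have "g \<in> K \<rightarrow> insert a A" using f by (auto simp: g_def Pi_def)
  moreover have "c i \<le> card {h \<in> K. g h = i}" if "i \<in> insert a A" for i
  proof (cases "i = a")
    case True
    have "card L \<le> card {h \<in> K. g h = a}"
      using L insert.prems by (intro card_mono) (auto simp: g_def)
    then show ?thesis using L True by simp
  next
    case False
    have "card {h \<in> K - L. f h = i} \<le> card {h \<in> K. g h = i}"
      using insert.prems by (intro card_mono) (auto simp: g_def)
    then show ?thesis using f(2) that False by force
  qed
  ultimately show ?case by blast
qed

text \<open>A partition into one-provider blocks is an assignment of the peers in \<open>S\<close> to the
  providers in \<open>S\<close>, of which only the block sizes matter. As the costs are nonincreasing, leaving
  peers unassigned in \<^const>\<open>alloc_min\<close> gains nothing.\<close>

lemma worth_eq_alloc_min: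
  assumes fin: "finite Z" "finite H" and disj: "Z \<inter> H = {}" and S: "S \<subseteq> Z \<union> H"
    and anti: "\<And>p. p \<in> Z \<Longrightarrow> antimono_on {0..1} (\<Omega> p (card H))"
  shows "worth Z H \<Omega> S = (\<Sum>p\<in>S \<inter> Z. \<Omega> p (card H) 0)
    - alloc_min (\<lambda>p. \<Omega> p (card H)) (card H) (S \<inter> Z) (card (S \<inter> H))"
proof -
  define n where "n = card H"
  have anti': "\<Omega> p n (real l / real n) \<le> \<Omega> p n (real k / real n)" if "p \<in> Z" "k \<le> l" "l \<le> n" for p k l
  proof -
    have "real l / real n \<le> 1" using that by (cases "n = 0") auto
    moreover have "real k / real n \<le> real l / real n" using that by (simp add: divide_right_mono)
    ultimately show ?thesis
      using monotone_onD[OF anti[OF that(1)], of "real k / real n" "real l / real n"] by (auto simp: n_def)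
  qed
  have finS: "finite S" "finite (S \<inter> Z)" using fin S finite_subset by blast+
  have kn: "card (T \<inter> H) \<le> n" for T unfolding n_def using fin by (intro card_mono) auto
  consider "S \<inter> Z = {}" | p where "S \<inter> Z = {p}" | "card (S \<inter> Z) \<ge> 2"
  proof -
    consider "card (S \<inter> Z) = 0" | "card (S \<inter> Z) = 1" | "card (S \<inter> Z) \<ge> 2" by linarith
    then show ?thesis
    proof cases
      case 1
      then show ?thesis using finS that(1) by simp
    next
      case 2
      then obtain p where "S \<inter> Z = {p}" by (rule card_1_singletonE)
      then show ?thesis by (rule that(2))
    next
      case 3
      then show ?thesis by (rule that(3))
    qed
  qed
  then have "worth Z H \<Omega> S = (\<Sum>p\<in>S \<inter> Z. \<Omega> p n 0) - alloc_min (\<lambda>p. \<Omega> p n) n (S \<inter> Z) (card (S \<inter> H))"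
  proof cases
    case 1
    then show ?thesis by (simp add: worth_def v_hat_def)
  next
    case (2 p)
    obtain c where c: "sum c {p} \<le> card (S \<inter> H)"
      "alloc_min (\<lambda>p. \<Omega> p n) n {p} (card (S \<inter> H)) = (\<Sum>i\<in>{p}. \<Omega> i n (real (c i) / real n))"
      using alloc_min_attained[of "{p}" "card (S \<inter> H)" "\<lambda>p. \<Omega> p n" n] by blast
    have "p \<in> Z" using 2 by auto
    then have "alloc_min (\<lambda>p. \<Omega> p n) n {p} (card (S \<inter> H)) \<ge> \<Omega> p n (real (card (S \<inter> H)) / real n)"
      using c kn[of S] by (auto intro!: anti')
    moreover have "alloc_min (\<lambda>p. \<Omega> p n) n {p} (card (S \<inter> H)) \<le> \<Omega> p n (real (card (S \<inter> H)) / real n)"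
      using alloc_min_le[of "{p}" "\<lambda>_. card (S \<inter> H)" "card (S \<inter> H)" "\<lambda>p. \<Omega> p n" n] by simp
    ultimately show ?thesis using 2 by (simp add: worth_def v_hat_def n_def)
  next
    case 3
    let ?V = "{\<Sum>C\<in>P. v_hat Z H \<Omega> C | P. partition_on S P \<and> (\<forall>C\<in>P. card (C \<inter> Z) = 1)}"
    let ?w = "(\<Sum>p\<in>S \<inter> Z. \<Omega> p n 0) - alloc_min (\<lambda>p. \<Omega> p n) n (S \<inter> Z) (card (S \<inter> H))"
    have le: "(\<Sum>C\<in>P. v_hat Z H \<Omega> C) \<le> ?w"
      if P: "partition_on S P" and one: "\<forall>C\<in>P. card (C \<inter> Z) = 1" for P
    proof -
      define pr where "pr C = the_elem (C \<inter> Z)" for C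
      have pr: "C \<inter> Z = {pr C}" if "C \<in> P" for C
      proof -
        have "card (C \<inter> Z) = 1" using one that by blast
        then obtain p where "C \<inter> Z = {p}" by (rule card_1_singletonE)
        then show ?thesis by (simp add: pr_def)
      qed
      \<comment> \<open>Each block contains one provider and each provider of \<open>S\<close> lies
        in one block, so blocks can be indexed by providers and the block sizes form an
        allocation.\<close>
      have bij: "bij_betw pr P (S \<inter> Z)"
        unfolding bij_betw_def
      proof
        show "inj_on pr P"
        proof (rule inj_onI)
          fix C D assume CD: "C \<in> P" "D \<in> P" "pr C = pr D"
          then have "pr C \<in> C \<inter> D" using pr[of C] pr[of D] by auto
          then show "C = D" using partition_onD2[OF P] CD by (auto simp: disjoint_def)
        qed
        show "pr ` P = S \<inter> Z"
        proof
          show "pr ` P \<subseteq> S \<inter> Z" using pr partition_onD1[OF P] by fastforce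
          show "S \<inter> Z \<subseteq> pr ` P"
          proof
            fix p assume "p \<in> S \<inter> Z"
            then obtain C where "C \<in> P" "p \<in> C \<inter> Z" using partition_onD1[OF P] by auto
            then show "p \<in> pr ` P" using pr[of C] by auto
          qed
        qed
      qed
      define blk where "blk = the_inv_into P pr"
      have blk: "blk (pr C) = C" if "C \<in> P" for C
        using bij that by (simp add: blk_def bij_betw_def the_inv_into_f_f)
      define c where "c p = card (blk p \<inter> H)" for p
      have finP: "finite P" using P finS finite_elements by blast
      have "(\<Sum>p\<in>S \<inter> Z. c p) = (\<Sum>C\<in>P. c (pr C))"
        by (rule sum.reindex_bij_betw[OF bij, symmetric])
      also have "\<dots> = (\<Sum>C\<in>P. card (C \<inter> H))"
        by (simp add: c_def blk)
      also have "\<dots> = card (\<Union>C\<in>P. C \<inter> H)"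
        using finP fin partition_onD2[OF P]
        by (intro card_UN_disjoint[symmetric]) (auto simp: disjoint_def)
      also have "(\<Union>C\<in>P. C \<inter> H) = S \<inter> H" using partition_onD1[OF P] by auto
      finally have "sum c (S \<inter> Z) \<le> card (S \<inter> H)" by simp
      from alloc_min_le[OF finS(2) this, of "\<lambda>p. \<Omega> p n" n]
      have "alloc_min (\<lambda>p. \<Omega> p n) n (S \<inter> Z) (card (S \<inter> H)) \<le> (\<Sum>p\<in>S \<inter> Z. \<Omega> p n (real (c p) / real n))" .
      moreover have "(\<Sum>C\<in>P. v_hat Z H \<Omega> C) = (\<Sum>C\<in>P. \<Omega> (pr C) n 0 - \<Omega> (pr C) n (real (c (pr C)) / real n))"
        using one by (intro sum.cong) (auto simp: v_hat_def pr_def[symmetric] n_def c_def blk Let_def)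
      moreover have "\<dots> = (\<Sum>p\<in>S \<inter> Z. \<Omega> p n 0 - \<Omega> p n (real (c p) / real n))"
        by (rule sum.reindex_bij_betw[OF bij])
      ultimately show ?thesis by (simp add: sum_subtractf)
    qed
    obtain c where c: "sum c (S \<inter> Z) \<le> card (S \<inter> H)"
      "alloc_min (\<lambda>p. \<Omega> p n) n (S \<inter> Z) (card (S \<inter> H)) = (\<Sum>i\<in>S \<inter> Z. \<Omega> i n (real (c i) / real n))"
      using alloc_min_attained[OF finS(2), of "card (S \<inter> H)" "\<lambda>p. \<Omega> p n" n] by blast
    have ne: "S \<inter> Z \<noteq> {}" using 3 by auto
    have finH: "finite (S \<inter> H)" using finS(1) by simp
    obtain f where f: "f \<in> S \<inter> H \<rightarrow> S \<inter> Z" "\<And>i. i \<in> S \<inter> Z \<Longrightarrow> c i \<le> card {h \<in> S \<inter> H. f h = i}"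
      using exists_assignment[OF finS(2) ne finH c(1)] by blast
    define blk where "blk p = insert p {h \<in> S \<inter> H. f h = p}" for p
    define P where "P = blk ` (S \<inter> Z)"
    have blkZ: "blk p \<inter> Z = {p}" and blkH: "blk p \<inter> H = {h \<in> S \<inter> H. f h = p}" if "p \<in> S \<inter> Z" for p
      using that disj by (auto simp: blk_def)
    have inj: "inj_on blk (S \<inter> Z)"
    proof (rule inj_onI)
      fix p q assume "p \<in> S \<inter> Z" "q \<in> S \<inter> Z" "blk p = blk q"
      then have "{p} = {q}" using blkZ by blast
      then show "p = q" by simp
    qed
    have part: "partition_on S P"
    proof (rule partition_onI)
      have "f h \<in> S \<inter> Z" if "h \<in> S \<inter> H" for h using f(1) that by blast
      then show "\<Union>P = S" using S by (auto simp: P_def blk_def)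
      show "disjnt p q" if "p \<in> P" "q \<in> P" "p \<noteq> q" for p q
        using that disj by (auto simp: P_def blk_def disjnt_def)
      show "{} \<notin> P" by (auto simp: P_def blk_def)
    qed
    have one: "\<forall>C\<in>P. card (C \<inter> Z) = 1" using blkZ by (auto simp: P_def)
    have "?w = (\<Sum>p\<in>S \<inter> Z. \<Omega> p n 0 - \<Omega> p n (real (c p) / real n))"
      using c(2) by (simp add: sum_subtractf)
    \<comment> \<open>The block of \<open>p\<close> may hold more than the \<open>c p\<close> peers
      of the optimal allocation; additional peers cannot raise its cost.\<close>
    also have "\<dots> \<le> (\<Sum>p\<in>S \<inter> Z. v_hat Z H \<Omega> (blk p))"
    proof (intro sum_mono)
      fix p assume p: "p \<in> S \<inter> Z"
      have "c p \<le> card (blk p \<inter> H)" using f(2)[OF p] blkH[OF p] by simp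
      from anti'[OF _ this kn] p
      show "\<Omega> p n 0 - \<Omega> p n (real (c p) / real n) \<le> v_hat Z H \<Omega> (blk p)"
        using blkZ[OF p] by (simp add: v_hat_def n_def[symmetric])
    qed
    also have "\<dots> = (\<Sum>C\<in>P. v_hat Z H \<Omega> C)"
      unfolding P_def by (simp add: sum.reindex[OF inj])
    finally have w: "?w = (\<Sum>C\<in>P. v_hat Z H \<Omega> C)" using le[OF part one] by (rule antisym)
    have "finite {P. partition_on S P}" by (rule finitely_many_partition_on[OF finS(1)])
    then have fin: "finite ((\<lambda>P. \<Sum>C\<in>P. v_hat Z H \<Omega> C) ` {P. partition_on S P})"
      by (rule finite_imageI)
    have "Max ?V = ?w"
    proof (rule Max_eqI)
      show "finite ?V" by (rule finite_subset[OF _ fin]) blast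
      show "y \<le> ?w" if "y \<in> ?V" for y using that le by blast
      show "?w \<in> ?V" unfolding mem_Collect_eq using w part one by blast
    qed
    then show ?thesis using 3 by (simp add: worth_def)
  qed
  then show ?thesis by (simp add: n_def)
qed

section \<open>Shapley sums grouped by provider set and number of peers\<close>

lemma sum_Pow_card:
  fixes g :: "nat \<Rightarrow> real"
  assumes "finite B"
  shows "(\<Sum>K\<in>Pow B. g (card K)) = (\<Sum>k\<le>card B. real (card B choose k) * g k)"
proof -
  have "(\<Sum>K\<in>Pow B. g (card K)) = (\<Sum>k\<le>card B. \<Sum>K | K \<in> Pow B \<and> card K = k. g (card K))"
    using assms by (intro sum.group[symmetric]) (auto intro: card_mono)
  also have "\<dots> = (\<Sum>k\<le>card B. real (card B choose k) * g k)"
    by (intro sum.cong) (auto simp: n_subsets[OF assms, symmetric] Collect_conj_eq)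
  finally show ?thesis .
qed

lemma sum_Pow_Un_card:
  fixes g :: "'a set \<Rightarrow> nat \<Rightarrow> real"
  assumes "finite A" "finite B" "A \<inter> B = {}"
  shows "(\<Sum>S\<in>Pow (A \<union> B). g (S \<inter> A) (card (S \<inter> B))) =
    (\<Sum>T\<in>Pow A. \<Sum>k\<le>card B. real (card B choose k) * g T k)"
proof -
  have "bij_betw (\<lambda>S. (S \<inter> A, S \<inter> B)) (Pow (A \<union> B)) (Pow A \<times> Pow B)"
    using assms(3) by (intro bij_betwI[where g = "\<lambda>(T, K). T \<union> K"]) auto
  from sum.reindex_bij_betw[OF this, of "\<lambda>(T, K). g T (card K)"]
  have "(\<Sum>S\<in>Pow (A \<union> B). g (S \<inter> A) (card (S \<inter> B))) = (\<Sum>(T, K)\<in>Pow A \<times> Pow B. g T (card K))"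
    by simp
  also have "\<dots> = (\<Sum>T\<in>Pow A. \<Sum>K\<in>Pow B. g T (card K))"
    by (rule sum.cartesian_product[symmetric])
  finally show ?thesis by (simp add: sum_Pow_card[OF assms(2)])
qed

text \<open>\<open>A\<close> and \<open>B\<close> are the providers and peers other than the player
  considered, which accounts for the \<open>+ 1\<close>. The \<open>card B choose k\<close> peer
  sets of size \<open>k\<close> share one weight, and this multiplicity is the binomial factor in
  \<open>beta_binomial\<close>.\<close>

lemma sum_shapley_weights:
  fixes D :: "'a set \<Rightarrow> nat \<Rightarrow> real"
  assumes "finite A" "finite B" "A \<inter> B = {}"
  shows "(\<Sum>S\<in>Pow (A \<union> B). fact (card S) * fact (card (A \<union> B) + 1 - card S - 1) / fact (card (A \<union> B) + 1)
      * D (S \<inter> A) (card (S \<inter> B)))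
    = (\<Sum>T\<in>Pow A. \<Sum>k\<le>card B. beta_binomial (card T) (card A - card T) (card B) k * D T k)"
proof -
  let ?g = "\<lambda>T k. fact (card T + k) * fact (card A - card T + card B - k) / fact (card A + card B + 1) * D T k"
  have card: "card (A \<union> B) = card A + card B" using assms by (simp add: card_Un_disjoint)
  have "fact (card S) * fact (card (A \<union> B) + 1 - card S - 1) / fact (card (A \<union> B) + 1)
      * D (S \<inter> A) (card (S \<inter> B)) = ?g (S \<inter> A) (card (S \<inter> B))" if "S \<in> Pow (A \<union> B)" for S
  proof -
    have "S = (S \<inter> A) \<union> (S \<inter> B)" using that by auto
    then have "card S = card (S \<inter> A) + card (S \<inter> B)"
      using assms card_Un_disjoint[of "S \<inter> A" "S \<inter> B"] by (auto simp: Int_assoc)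
    moreover have "card (S \<inter> A) \<le> card A" "card (S \<inter> B) \<le> card B" using assms by (auto intro: card_mono)
    ultimately show ?thesis using card by (simp add: add.commute)
  qed
  then have "(\<Sum>S\<in>Pow (A \<union> B). fact (card S) * fact (card (A \<union> B) + 1 - card S - 1) / fact (card (A \<union> B) + 1)
      * D (S \<inter> A) (card (S \<inter> B))) = (\<Sum>S\<in>Pow (A \<union> B). ?g (S \<inter> A) (card (S \<inter> B)))"
    by (intro sum.cong) auto
  also have "\<dots> = (\<Sum>T\<in>Pow A. \<Sum>k\<le>card B. real (card B choose k) * ?g T k)"
    by (rule sum_Pow_Un_card[OF assms])
  also have "\<dots> = (\<Sum>T\<in>Pow A. \<Sum>k\<le>card B. beta_binomial (card T) (card A - card T) (card B) k * D T k)"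
  proof (intro sum.cong refl)
    fix T k assume "T \<in> Pow A"
    then have "card T \<le> card A" using assms by (auto intro: card_mono)
    then show "real (card B choose k) * ?g T k = beta_binomial (card T) (card A - card T) (card B) k * D T k"
      by (simp add: beta_binomial_def)
  qed
  finally show ?thesis .
qed

text \<open>These are the Shapley weights of all coalitions of the other players: each size receives
  the same total, the reciprocal of the number of players. The lemma extracts constants from
  weighted sums.\<close>

lemma sum_beta_binomial:
  assumes "finite A" "finite B" "A \<inter> B = {}"
  shows "(\<Sum>T\<in>Pow A. \<Sum>k\<le>card B. beta_binomial (card T) (card A - card T) (card B) k) = 1"
proof -
  let ?m = "card (A \<union> B)"
  have "(\<Sum>T\<in>Pow A. \<Sum>k\<le>card B. beta_binomial (card T) (card A - card T) (card B) k)
    = (\<Sum>S\<in>Pow (A \<union> B). fact (card S) * fact (?m + 1 - card S - 1) / fact (?m + 1))"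
    using sum_shapley_weights[OF assms, of "\<lambda>_ _. 1"] by simp
  also have "\<dots> = (\<Sum>s\<le>?m. real (?m choose s) * (fact s * fact (?m + 1 - s - 1) / fact (?m + 1)))"
    using assms by (intro sum_Pow_card) auto
  also have "\<dots> = (\<Sum>s\<le>?m. 1 / real (?m + 1))"
  proof (intro sum.cong refl)
    fix s assume "s \<in> {..?m}"
    then have "real (?m choose s) * (fact s * fact (?m - s)) = fact ?m"
      by (simp add: binomial_fact)
    then have "real (?m choose s) * (fact s * fact (?m - s) / fact (?m + 1)) = fact ?m / fact (?m + 1)"
      by (simp only: times_divide_eq_right)
    also have "\<dots> = 1 / real (?m + 1)" by (simp add: divide_simps)
    finally show "real (?m choose s) * (fact s * fact (?m + 1 - s - 1) / fact (?m + 1)) = 1 / real (?m + 1)"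
      by simp
  qed
  finally show ?thesis by simp
qed

lemma shapley_eq_sum_beta_binomial:
  assumes "finite A" "finite B" "A \<inter> B = {}" "i \<notin> A \<union> B"
    and "\<And>T K. T \<subseteq> A \<Longrightarrow> K \<subseteq> B \<Longrightarrow> v (T \<union> K \<union> {i}) - v (T \<union> K) = D T (card K)"
  shows "shapley (insert i (A \<union> B)) v i =
    (\<Sum>T\<in>Pow A. \<Sum>k\<le>card B. beta_binomial (card T) (card A - card T) (card B) k * D T k)"
proof -
  have "v (S \<union> {i}) - v S = D (S \<inter> A) (card (S \<inter> B))" if "S \<in> Pow (A \<union> B)" for S
  proof -
    have "S = (S \<inter> A) \<union> (S \<inter> B)" using that by auto
    then show ?thesis using assms(5)[of "S \<inter> A" "S \<inter> B"] by auto
  qed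
  moreover have "insert i (A \<union> B) - {i} = A \<union> B" "card (insert i (A \<union> B)) = card (A \<union> B) + 1"
    using assms(1,2,4) by auto
  ultimately have "shapley (insert i (A \<union> B)) v i = (\<Sum>S\<in>Pow (A \<union> B).
      fact (card S) * fact (card (A \<union> B) + 1 - card S - 1) / fact (card (A \<union> B) + 1) * D (S \<inter> A) (card (S \<inter> B)))"
    unfolding shapley_def by (intro sum.cong) simp_all
  then show ?thesis by (simp only: sum_shapley_weights[OF assms(1-3)])
qed

lemma worth_Un:
  assumes "finite Z" "finite H" "Z \<inter> H = {}" "T \<subseteq> Z" "K \<subseteq> H"
    and "\<And>p. p \<in> Z \<Longrightarrow> antimono_on {0..1} (\<Omega> p (card H))"
  shows "worth Z H \<Omega> (T \<union> K) = (\<Sum>p\<in>T. \<Omega> p (card H) 0)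
    - alloc_min (\<lambda>p. \<Omega> p (card H)) (card H) T (card K)"
proof -
  have "(T \<union> K) \<inter> Z = T" "(T \<union> K) \<inter> H = K" using assms(3-5) by auto
  then show ?thesis
    using worth_eq_alloc_min[OF assms(1-3), of "T \<union> K" \<Omega>] assms(4-6) by (simp add: le_supI1 le_supI2)
qed

text \<open>The standalone cost of \<open>p\<close> occurs in each of its marginal contributions
  and, as the weights sum to 1, comes out as a single term.\<close>

lemma shapley_provider:
  assumes fin: "finite Z" "finite H" and disj: "Z \<inter> H = {}" and sub: "Zbar \<subseteq> Z" "Hbar \<subseteq> H"
    and anti: "\<And>p. p \<in> Z \<Longrightarrow> antimono_on {0..1} (\<Omega> p (card H))" and p: "p \<in> Zbar"
  defines "n \<equiv> card H"
  shows "shapley (Zbar \<union> Hbar) (worth Z H \<Omega>) p = \<Omega> p n 0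
    - (\<Sum>T\<in>Pow (Zbar - {p}). \<Sum>k\<le>card Hbar. beta_binomial (card T) (card Zbar - 1 - card T) (card Hbar) k *
        (alloc_min (\<lambda>i. \<Omega> i n) n (T \<union> {p}) k - alloc_min (\<lambda>i. \<Omega> i n) n T k))"
proof -
  let ?A = "Zbar - {p}"
  let ?al = "alloc_min (\<lambda>i. \<Omega> i n) n"
  have finA: "finite Zbar" "finite ?A" "finite Hbar" using fin sub finite_subset by blast+
  have dis: "?A \<inter> Hbar = {}" "p \<notin> ?A \<union> Hbar" using disj sub p by auto
  note W = worth_Un[where \<Omega> = \<Omega>, OF fin disj _ _ anti]
  have "worth Z H \<Omega> (T \<union> K \<union> {p}) - worth Z H \<Omega> (T \<union> K) = \<Omega> p n 0 - (?al (T \<union> {p}) (card K) - ?al T (card K))"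
    if "T \<subseteq> ?A" "K \<subseteq> Hbar" for T K
  proof -
    have "finite T" "p \<notin> T" using that finA finite_subset by blast+
    then have "(\<Sum>i\<in>T \<union> {p}. \<Omega> i n 0) = \<Omega> p n 0 + (\<Sum>i\<in>T. \<Omega> i n 0)" by simp
    moreover have "T \<union> {p} \<subseteq> Z" "T \<subseteq> Z" "K \<subseteq> H" using that sub p by auto
    moreover have "T \<union> K \<union> {p} = (T \<union> {p}) \<union> K" by auto
    ultimately show ?thesis
      using W[of "T \<union> {p}" K] W[of T K] by (simp add: n_def)
  qed
  from shapley_eq_sum_beta_binomial[OF finA(2,3) dis, where D = "\<lambda>T k. \<Omega> p n 0 - (?al (T \<union> {p}) k - ?al T k)", OF this]
  have "shapley (insert p (?A \<union> Hbar)) (worth Z H \<Omega>) p =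
    (\<Sum>T\<in>Pow ?A. \<Sum>k\<le>card Hbar. beta_binomial (card T) (card ?A - card T) (card Hbar) k
      * (\<Omega> p n 0 - (?al (T \<union> {p}) k - ?al T k)))" .
  also have "\<dots> = (\<Sum>T\<in>Pow ?A. \<Sum>k\<le>card Hbar. beta_binomial (card T) (card ?A - card T) (card Hbar) k) * \<Omega> p n 0
    - (\<Sum>T\<in>Pow ?A. \<Sum>k\<le>card Hbar. beta_binomial (card T) (card ?A - card T) (card Hbar) k * (?al (T \<union> {p}) k - ?al T k))"
    by (simp add: sum_distrib_right sum_subtractf right_diff_distrib)
  also have "insert p (?A \<union> Hbar) = Zbar \<union> Hbar" using p by auto
  also have "card ?A = card Zbar - 1" using p by simp
  finally show ?thesis using sum_beta_binomial[OF finA(2,3) dis(1)] p by simp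
qed

text \<open>A joining peer leaves the provider set unchanged, so the standalone costs cancel and
  only the step from k to k + 1 peers remains. The peer itself is missing from the pool, hence
  \<open>card Hbar - 1\<close>.\<close>

lemma shapley_peer:
  assumes fin: "finite Z" "finite H" and disj: "Z \<inter> H = {}" and sub: "Zbar \<subseteq> Z" "Hbar \<subseteq> H"
    and anti: "\<And>p. p \<in> Z \<Longrightarrow> antimono_on {0..1} (\<Omega> p (card H))" and i: "i \<in> Hbar"
  defines "n \<equiv> card H"
  shows "shapley (Zbar \<union> Hbar) (worth Z H \<Omega>) i =
    (\<Sum>T\<in>Pow Zbar. \<Sum>k\<le>card Hbar - 1. beta_binomial (card T) (card Zbar - card T) (card Hbar - 1) k *
        (alloc_min (\<lambda>i. \<Omega> i n) n T k - alloc_min (\<lambda>i. \<Omega> i n) n T (k + 1)))"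
proof -
  let ?B = "Hbar - {i}"
  let ?al = "alloc_min (\<lambda>i. \<Omega> i n) n"
  have finA: "finite Zbar" "finite ?B" using fin sub finite_subset by blast+
  have dis: "Zbar \<inter> ?B = {}" "i \<notin> Zbar \<union> ?B" using disj sub i by auto
  note W = worth_Un[where \<Omega> = \<Omega>, OF fin disj _ _ anti]
  have "worth Z H \<Omega> (T \<union> K \<union> {i}) - worth Z H \<Omega> (T \<union> K) = ?al T (card K) - ?al T (card K + 1)"
    if "T \<subseteq> Zbar" "K \<subseteq> ?B" for T K
  proof -
    have "finite K" "i \<notin> K" using that finA finite_subset by blast+
    then have "card (K \<union> {i}) = card K + 1" by simp
    moreover have "K \<union> {i} \<subseteq> H" "T \<subseteq> Z" "K \<subseteq> H" using that sub i by auto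
    moreover have "T \<union> K \<union> {i} = T \<union> (K \<union> {i})" by auto
    ultimately show ?thesis
      using W[of T "K \<union> {i}"] W[of T K] by (simp add: n_def)
  qed
  from shapley_eq_sum_beta_binomial[OF finA dis, where D = "\<lambda>T k. ?al T k - ?al T (k + 1)", OF this]
  have "shapley (insert i (Zbar \<union> ?B)) (worth Z H \<Omega>) i =
    (\<Sum>T\<in>Pow Zbar. \<Sum>k\<le>card ?B. beta_binomial (card T) (card Zbar - card T) (card ?B) k *
        (?al T k - ?al T (k + 1)))" .
  moreover have "insert i (Zbar \<union> ?B) = Zbar \<union> Hbar" using i by auto
  moreover have "card ?B = card Hbar - 1" using i by simp
  ultimately show ?thesis by simp
qed

lemma aumann_dreze_eq_shapley:
  assumes "partition_on N P" "C \<in> P" "i \<in> C"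
  shows "aumann_dreze P v i = shapley C v i"
proof -
  have "(THE D. D \<in> P \<and> i \<in> D) = C"
    using assms partition_onD2[OF assms(1)] by (intro the_equality) (auto simp: disjoint_def)
  then show ?thesis by (simp add: aumann_dreze_def)
qed

section \<open>The fluid limit\<close>

text \<open>The case \<open>x > 0\<close>, with \<open>h j\<close> the number of assisting peers.
  Positivity of \<open>x\<close> makes \<open>h\<close> tend to infinity.\<close>

locale fluid_costs =
  fixes Z :: "'a set" and \<Omega> :: "'a \<Rightarrow> nat \<Rightarrow> real \<Rightarrow> real" and \<Omega>t :: "'a \<Rightarrow> real \<Rightarrow> real"
    and \<eta> h :: "nat \<Rightarrow> nat" and x :: real
  assumes finite_Z: "finite Z"
    and cost_nonneg: "\<And>p m t. p \<in> Z \<Longrightarrow> 0 < m \<Longrightarrow> t \<in> {0..1} \<Longrightarrow> 0 \<le> \<Omega> p m t"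
    and cost_antimono: "\<And>p m. p \<in> Z \<Longrightarrow> 0 < m \<Longrightarrow> antimono_on {0..1} (\<Omega> p m)"
    and fluid_limit: "\<And>p t. p \<in> Z \<Longrightarrow> t \<in> {0..1} \<Longrightarrow> (\<lambda>m. \<Omega> p m t / real m) \<longlonglongrightarrow> \<Omega>t p t"
    and eta_pos: "\<And>j. 0 < \<eta> j"
    and eta_limit: "filterlim \<eta> at_top sequentially"
    and x_pos: "0 < x" and x_le_1: "x \<le> 1"
    and fraction: "\<And>j. real (h j) = x * real (\<eta> j)"
begin

text \<open>The costs are unspecified outside \<open>[0, 1]\<close>; cutting arguments off at \<open>x\<close> makes them monotone on
  the whole line, and makes \<open>x\<close> a continuity point of \<open>M_Omega\<close> when they are continuous on
  \<open>[0, x]\<close>.\<close>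

definition cut :: "real \<Rightarrow> real" where "cut t = max 0 (min t x)"

definition scaled_cost :: "nat \<Rightarrow> 'a \<Rightarrow> real \<Rightarrow> real" where
  "scaled_cost j i t = \<Omega> i (\<eta> j) (cut t) / real (\<eta> j)"

definition cut_limit :: "'a \<Rightarrow> real \<Rightarrow> real" where "cut_limit i t = \<Omega>t i (cut t)"

definition scaled_min :: "'a set \<Rightarrow> nat \<Rightarrow> nat \<Rightarrow> real" where
  "scaled_min S j k = alloc_min (\<lambda>i. \<Omega> i (\<eta> j)) (\<eta> j) S k / real (\<eta> j)"

lemma cut_in: "cut t \<in> {0..1}" "cut t \<in> {0..x}"
  using x_pos x_le_1 by (auto simp: cut_def)

lemma cut_eq: "0 \<le> t \<Longrightarrow> t \<le> x \<Longrightarrow> cut t = t"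
  by (simp add: cut_def)

lemma antimono_scaled_cost: "i \<in> Z \<Longrightarrow> antimono (scaled_cost j i)"
proof (rule antimonoI)
  fix s t :: real assume "i \<in> Z" "s \<le> t"
  moreover from this have "cut s \<le> cut t" by (auto simp: cut_def)
  ultimately have "\<Omega> i (\<eta> j) (cut t) \<le> \<Omega> i (\<eta> j) (cut s)"
    using monotone_onD[OF cost_antimono[OF _ eta_pos], of i "cut s" "cut t" j] cut_in by simp
  then show "scaled_cost j i t \<le> scaled_cost j i s"
    by (simp add: scaled_cost_def divide_right_mono)
qed

lemma scaled_cost_tendsto: "i \<in> Z \<Longrightarrow> (\<lambda>j. scaled_cost j i t) \<longlonglongrightarrow> cut_limit i t"
  unfolding scaled_cost_def cut_limit_def
  by (rule filterlim_compose[OF fluid_limit eta_limit]) (use cut_in in auto)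

lemma cut_limit_nonneg: "i \<in> Z \<Longrightarrow> 0 \<le> cut_limit i t"
  by (rule LIMSEQ_le_const[OF scaled_cost_tendsto])
     (use cut_in cost_nonneg eta_pos in \<open>auto simp: scaled_cost_def\<close>)

lemma antimono_cut_limit: "i \<in> Z \<Longrightarrow> antimono (cut_limit i)"
proof (rule antimonoI)
  fix s t :: real assume "i \<in> Z" "s \<le> t"
  then show "cut_limit i t \<le> cut_limit i s"
    using antimonoD[OF antimono_scaled_cost]
    by (intro LIMSEQ_le[OF scaled_cost_tendsto scaled_cost_tendsto]) auto
qed

lemma finite_subset_Z: "S \<subseteq> Z \<Longrightarrow> finite S"
  using finite_Z finite_subset by blast

lemma M_Omega_cut_limit: "S \<subseteq> Z \<Longrightarrow> y \<le> x \<Longrightarrow> M_Omega cut_limit S y = M_Omega \<Omega>t S y"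
  by (rule M_Omega_cong) (auto simp: cut_limit_def cut_eq finite_subset_Z)

text \<open>At most \<open>h j\<close> peers are distributed, and h/\<eta> = x, so the cut-off never
  takes effect on the sampled arguments.\<close>

lemma scaled_min_eq:
  assumes "S \<subseteq> Z" "k \<le> h j"
  shows "scaled_min S j k = alloc_min (scaled_cost j) (\<eta> j) S k"
  unfolding scaled_min_def
proof (rule alloc_min_divide[symmetric])
  fix i c assume "c \<le> k"
  then have "real c \<le> x * real (\<eta> j)" using assms(2) fraction[of j] by linarith
  then have "cut (real c / real (\<eta> j)) = real c / real (\<eta> j)"
    using eta_pos[of j] by (intro cut_eq) (auto simp: pos_divide_le_eq)
  then show "scaled_cost j i (real c / real (\<eta> j)) = \<Omega> i (\<eta> j) (real c / real (\<eta> j)) / real (\<eta> j)"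
    by (simp add: scaled_cost_def)
qed (use assms eta_pos finite_subset_Z in auto)

lemma scaled_min_tendsto:
  assumes S: "S \<subseteq> Z" and k: "\<And>j. k j \<le> h j" "(\<lambda>j. real (k j) / real (\<eta> j)) \<longlonglongrightarrow> y"
    and y: "0 < y" "isCont (M_Omega cut_limit S) y"
  shows "(\<lambda>j. scaled_min S j (k j)) \<longlonglongrightarrow> M_Omega cut_limit S y"
proof -
  have "(\<lambda>j. alloc_min (\<lambda>i. scaled_cost j i) (\<eta> j) S (k j)) \<longlonglongrightarrow> M_Omega cut_limit S y"
    using S by (intro alloc_min_tendsto_M_Omega[where G = "\<lambda>i j. scaled_cost j i"] finite_subset_Z
        cut_limit_nonneg antimono_scaled_cost scaled_cost_tendsto eta_limit k y) auto
  then show ?thesis using S k(1) by (simp add: scaled_min_eq)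
qed

text \<open>The minimum lies between 0 and the cost of assigning no peers, which converges and is
  therefore bounded in j.\<close>

lemma scaled_min_bounded:
  assumes S: "S \<subseteq> Z"
  obtains B where "\<And>j k. k \<le> h j \<Longrightarrow> \<bar>scaled_min S j k\<bar> \<le> B"
proof -
  have "(\<lambda>j. \<Sum>i\<in>S. scaled_cost j i 0) \<longlonglongrightarrow> (\<Sum>i\<in>S. cut_limit i 0)"
    using S by (intro tendsto_sum scaled_cost_tendsto) auto
  then have "Bseq (\<lambda>j. \<Sum>i\<in>S. scaled_cost j i 0)"
    by (rule convergent_imp_Bseq[OF convergentI])
  then obtain B where B: "\<And>j. \<bar>\<Sum>i\<in>S. scaled_cost j i 0\<bar> \<le> B"
    unfolding Bseq_def by auto
  have "\<bar>scaled_min S j k\<bar> \<le> B" if "k \<le> h j" for j k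
  proof -
    have "scaled_min S j k \<le> (\<Sum>i\<in>S. scaled_cost j i 0)"
      using alloc_min_le[OF finite_subset_Z[OF S], of "\<lambda>_. 0" k "scaled_cost j" "\<eta> j"] that S
      by (simp add: scaled_min_eq)
    moreover have "0 \<le> scaled_min S j k"
      unfolding scaled_min_eq[OF S that]
      by (rule alloc_min_nonneg[OF finite_subset_Z[OF S]])
         (use S cost_nonneg cut_in eta_pos in \<open>auto simp: scaled_cost_def subset_iff\<close>)
    ultimately show ?thesis using B[of j] by linarith
  qed
  then show ?thesis by (rule that)
qed

lemma h_limit: "filterlim h at_top sequentially"
proof -
  have "filterlim (\<lambda>j. real (\<eta> j)) at_top sequentially"
    by (rule filterlim_compose[OF filterlim_real_sequentially eta_limit])
  then have "filterlim (\<lambda>j. real (h j)) at_top sequentially"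
    unfolding fraction using x_pos by (intro filterlim_tendsto_pos_mult_at_top[OF tendsto_const])
  then show ?thesis by (simp add: filterlim_sequentially_iff_filterlim_real)
qed

definition exceptional :: "'a set \<Rightarrow> real set" where
  "exceptional S = {u. 0 < u * x \<and> \<not> isCont (M_Omega cut_limit S) (u * x)}"

lemma negligible_exceptional:
  assumes "S \<subseteq> Z"
  shows "negligible (exceptional S)"
proof -
  have "countable {y. 0 < y \<and> \<not> isCont (M_Omega cut_limit S) y}"
    using assms by (intro countable_M_Omega_discontinuities finite_subset_Z cut_limit_nonneg) auto
  then have "countable ((\<lambda>y. y / x) ` {y. 0 < y \<and> \<not> isCont (M_Omega cut_limit S) y})"
    by (rule countable_image)
  moreover have "exceptional S \<subseteq> (\<lambda>y. y / x) ` {y. 0 < y \<and> \<not> isCont (M_Omega cut_limit S) y}"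
    using x_pos by (auto simp: exceptional_def intro!: image_eqI[of _ _ "_ * x"])
  ultimately have "countable (exceptional S)" by (rule countable_subset[rotated])
  then show ?thesis
    by (simp add: negligible_iff_null_sets countable_imp_null_set_lborel null_sets_completionI)
qed

lemma scaled_min_step_tendsto:
  assumes S: "S \<subseteq> Z" and u: "u \<in> {0<..<1} - exceptional S"
  shows "(\<lambda>j. scaled_min S j (nat \<lfloor>real (h j + 1) * u\<rfloor>)) \<longlonglongrightarrow> M_Omega \<Omega>t S (u * x)"
proof -
  let ?k = "\<lambda>j. nat \<lfloor>real (h j + 1) * u\<rfloor>"
  \<comment> \<open>The error 2 consists of one unit for the floor and less than one for replacing
    \<open>h j + 1\<close> by \<open>h j\<close>.\<close>
  have k: "?k j \<le> h j" "\<bar>real (?k j) - real (h j) * u\<bar> \<le> 2" for j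
  proof -
    have "real (h j + 1) * u < real (h j + 1)" using u by simp
    then show "?k j \<le> h j" by linarith
    have "0 \<le> real (h j + 1) * u" using u by simp
    then have "\<bar>real (?k j) - real (h j + 1) * u\<bar> \<le> 1" by linarith
    moreover have "real (h j + 1) * u = real (h j) * u + u" by (simp add: algebra_simps)
    moreover have "0 < u" "u < 1" using u by auto
    ultimately show "\<bar>real (?k j) - real (h j) * u\<bar> \<le> 2" by linarith
  qed
  have "(\<lambda>j. 2 * inverse (real (\<eta> j))) \<longlonglongrightarrow> 2 * 0"
    by (intro tendsto_intros tendsto_inverse_0_at_top filterlim_compose[OF filterlim_real_sequentially eta_limit])
  then have lim0: "(\<lambda>j. 2 / real (\<eta> j)) \<longlonglongrightarrow> 0" by (simp add: divide_inverse)
  have "(\<lambda>j. real (?k j) / real (\<eta> j) - u * x) \<longlonglongrightarrow> 0"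
  proof (rule Lim_null_comparison[OF always_eventually lim0], rule allI)
    fix j
    have "real (?k j) / real (\<eta> j) - u * x = (real (?k j) - real (h j) * u) / real (\<eta> j)"
      using eta_pos[of j] by (simp add: fraction field_simps)
    then show "norm (real (?k j) / real (\<eta> j) - u * x) \<le> 2 / real (\<eta> j)"
      using k(2)[of j] by (simp add: divide_right_mono)
  qed
  then have "(\<lambda>j. real (?k j) / real (\<eta> j)) \<longlonglongrightarrow> u * x" by (rule LIM_zero_cancel)
  moreover have "0 < u * x" "u * x \<le> x" "isCont (M_Omega cut_limit S) (u * x)"
    using u x_pos by (auto simp: exceptional_def)
  ultimately show ?thesis
    using scaled_min_tendsto[OF S k(1), of "u * x"] by (simp add: M_Omega_cut_limit[OF S])
qed

lemma sum_scaled_min_tendsto: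
  assumes "S \<subseteq> Z"
  shows "(\<lambda>u. u ^ a * (1 - u) ^ b * M_Omega \<Omega>t S (u * x)) integrable_on {0..1}"
    and "(\<lambda>j. \<Sum>k\<le>h j. beta_binomial a b (h j) k * scaled_min S j k)
      \<longlonglongrightarrow> integral {0..1} (\<lambda>u. u ^ a * (1 - u) ^ b * M_Omega \<Omega>t S (u * x))"
proof -
  obtain B where B: "\<And>j k. k \<le> h j \<Longrightarrow> \<bar>scaled_min S j k\<bar> \<le> B"
    using scaled_min_bounded[OF assms] by blast
  show "(\<lambda>u. u ^ a * (1 - u) ^ b * M_Omega \<Omega>t S (u * x)) integrable_on {0..1}"
    "(\<lambda>j. \<Sum>k\<le>h j. beta_binomial a b (h j) k * scaled_min S j k)
      \<longlonglongrightarrow> integral {0..1} (\<lambda>u. u ^ a * (1 - u) ^ b * M_Omega \<Omega>t S (u * x))"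
    using beta_binomial_sum_tendsto[where m = "scaled_min S" and F = "\<lambda>u. M_Omega \<Omega>t S (u * x)",
        OF h_limit B negligible_exceptional[OF assms] scaled_min_step_tendsto[OF assms]] by blast+
qed

lemma sum_marginal_cost_tendsto:
  assumes "S \<subseteq> Z" "T \<subseteq> Z"
  shows "(\<lambda>j. \<Sum>k\<le>h j. beta_binomial a b (h j) k * (scaled_min S j k - scaled_min T j k))
      \<longlonglongrightarrow> integral {0..1} (\<lambda>u. u ^ a * (1 - u) ^ b * (M_Omega \<Omega>t S (u * x) - M_Omega \<Omega>t T (u * x)))"
  using tendsto_diff[OF sum_scaled_min_tendsto(2)[OF assms(1)] sum_scaled_min_tendsto(2)[OF assms(2)], of a b a b]
    integral_diff[OF sum_scaled_min_tendsto(1)[OF assms(1)] sum_scaled_min_tendsto(1)[OF assms(2)], of a b a b]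
  by (simp add: right_diff_distrib sum_subtractf)

text \<open>A single provider does best by taking everything, since its cost is nonincreasing.
  Regularity assumed for singleton minima thus becomes continuity of the costs themselves.\<close>

lemma cut_limit_eq_M_Omega:
  assumes "i \<in> Z" "0 \<le> y" "y \<le> x"
  shows "cut_limit i y = M_Omega \<Omega>t {i} y"
proof -
  have "M_Omega cut_limit {i} y \<le> cut_limit i y"
    using M_Omega_le[of "{i}" cut_limit "\<lambda>_. y" y] cut_limit_nonneg assms by simp
  moreover have "cut_limit i y \<le> M_Omega cut_limit {i} y"
    using antimonoD[OF antimono_cut_limit] assms by (intro M_Omega_greatest) auto
  ultimately show ?thesis using M_Omega_cut_limit[of "{i}" y] assms by simp
qed

text \<open>The cut-off costs are constant outside [0, x], so continuity on that interval is uniform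
  on the whole line. This makes \<open>x\<close> a two-sided continuity point, as required for the
  boundary term with all \<open>h j\<close> peers.\<close>

lemma isCont_M_Omega_cut_limit:
  assumes S: "S \<subseteq> Z" and reg: "\<And>i. i \<in> S \<Longrightarrow> derivative_regular x (M_Omega \<Omega>t {i})"
  shows "isCont (M_Omega cut_limit S) x"
proof -
  have "uniformly_continuous_on UNIV (cut_limit i)" if i: "i \<in> S" for i
  proof -
    have "continuous_on {0..x} (M_Omega \<Omega>t {i})"
      using reg[OF i] by (simp add: derivative_regular_def abs_continuous_on_imp_continuous_on)
    then have "continuous_on {0..x} (cut_limit i)"
      by (rule continuous_on_eq) (use cut_limit_eq_M_Omega S i in auto)
    then have "uniformly_continuous_on {0..x} (cut_limit i)"
      by (rule compact_uniformly_continuous) auto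
    then have *: "uniformly_continuous_on (cut ` UNIV) (cut_limit i)"
      unfolding uniformly_continuous_on_def using cut_in(2) by (metis imageE)
    have "dist (cut s) (cut t) \<le> dist s t" for s t by (auto simp: cut_def dist_real_def)
    then have "uniformly_continuous_on UNIV cut"
      unfolding uniformly_continuous_on_def by (meson le_less_trans)
    from uniformly_continuous_on_compose[OF this *]
    have "uniformly_continuous_on UNIV (\<lambda>t. cut_limit i (cut t))" .
    \<comment> \<open>\<open>cut_limit\<close> already contains one cut, so precomposing with
      another does not change it.\<close>
    moreover have "cut (cut t) = cut t" for t by (rule cut_eq) (use cut_in in auto)
    ultimately show ?thesis by (simp add: cut_limit_def[abs_def])
  qed
  then have "continuous_on {0..} (M_Omega cut_limit S)"
    using S by (intro continuous_on_M_Omega finite_subset_Z cut_limit_nonneg) auto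
  then show ?thesis
    using x_pos by (intro continuous_on_interior[of "{0..}"]) auto
qed

text \<open>Summation by parts expresses \<open>h j\<close> times the sum of differences of
  \<open>scaled_min\<close> through boundary values and undifferenced sums, all of which converge.
  Their limit is the right-hand side of \<open>integral_bernstein_times_deriv\<close>, which turns
  it back into an integral of the derivative.\<close>

lemma sum_peer_marginal_tendsto:
  assumes S: "S \<subseteq> Z" and reg: "derivative_regular x (M_Omega \<Omega>t S)"
    and reg': "\<And>i. i \<in> S \<Longrightarrow> derivative_regular x (M_Omega \<Omega>t {i})"
  shows "(\<lambda>j. \<Sum>k\<le>h j - 1. beta_binomial a b (h j - 1) k *
        (alloc_min (\<lambda>i. \<Omega> i (\<eta> j)) (\<eta> j) S k - alloc_min (\<lambda>i. \<Omega> i (\<eta> j)) (\<eta> j) S (k + 1)))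
      \<longlonglongrightarrow> - integral {0..1} (\<lambda>u. u ^ a * (1 - u) ^ b * deriv (M_Omega \<Omega>t S) (u * x))"
proof -
  let ?M = "M_Omega \<Omega>t S" and ?m = "scaled_min S"
  let ?I = "\<lambda>a b. integral {0..1} (\<lambda>u. u ^ a * (1 - u) ^ b * ?M (u * x))"
  let ?L = "(if b = 0 then ?M x else 0) - (if a = 0 then ?M 0 else 0)
    - real a * ?I (a - 1) b + real b * ?I a (b - 1)"
  have h_pos: "0 < h j" for j
  proof -
    have "0 < real (h j)" unfolding fraction using x_pos eta_pos by simp
    then show ?thesis by simp
  qed
  have m0: "(\<lambda>j. ?m j 0) \<longlonglongrightarrow> ?M 0"
  proof -
    have "(\<lambda>j. \<Sum>i\<in>S. scaled_cost j i 0) \<longlonglongrightarrow> (\<Sum>i\<in>S. cut_limit i 0)"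
      using S by (intro tendsto_sum scaled_cost_tendsto) auto
    moreover have "?M 0 = (\<Sum>i\<in>S. cut_limit i 0)"
      using M_Omega_cut_limit[OF S, of 0] M_Omega_0[OF finite_subset_Z[OF S]] x_pos by simp
    ultimately show ?thesis
      using S by (simp add: scaled_min_eq alloc_min_0[OF finite_subset_Z])
  qed
  have mh: "(\<lambda>j. ?m j (h j)) \<longlonglongrightarrow> ?M x"
  proof -
    have "(\<lambda>j. real (h j) / real (\<eta> j)) \<longlonglongrightarrow> x"
      using eta_pos by (simp add: fraction less_imp_neq[THEN not_sym])
    then show ?thesis
      using scaled_min_tendsto[OF S order_refl _ x_pos isCont_M_Omega_cut_limit[OF S reg']]
        M_Omega_cut_limit[OF S order_refl] by simp
  qed
  have "(\<lambda>j. (if b = 0 then ?m j (h j) else 0) - (if a = 0 then ?m j 0 else 0)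
    - real a * (\<Sum>k\<le>h j. beta_binomial (a - 1) b (h j) k * ?m j k)
    + real b * (\<Sum>k\<le>h j. beta_binomial a (b - 1) (h j) k * ?m j k)) \<longlonglongrightarrow> ?L"
    by (intro tendsto_intros sum_scaled_min_tendsto(2)[OF S]) (auto intro: m0 mh)
  moreover have "real (h j) * (\<Sum>k\<le>h j - 1. beta_binomial a b (h j - 1) k * (?m j (k + 1) - ?m j k)) =
    (if b = 0 then ?m j (h j) else 0) - (if a = 0 then ?m j 0 else 0)
    - real a * (\<Sum>k\<le>h j. beta_binomial (a - 1) b (h j) k * ?m j k)
    + real b * (\<Sum>k\<le>h j. beta_binomial a (b - 1) (h j) k * ?m j k)" for j
  proof -
    have "h j - 1 + 1 = h j" using h_pos[of j] by simp
    then show ?thesis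
      using beta_binomial_summation_by_parts[of "h j - 1" a b "?m j"] by (simp only:)
  qed
  ultimately have "(\<lambda>j. real (h j) * (\<Sum>k\<le>h j - 1. beta_binomial a b (h j - 1) k * (?m j (k + 1) - ?m j k))) \<longlonglongrightarrow> ?L"
    by (simp only:)
  \<comment> \<open>\<open>scaled_min\<close> carries a factor 1/\<eta> and the sum a factor
    \<open>h j\<close>, which together amount to \<open>x\<close>. Division by \<open>- x\<close>
    restores the unscaled saving m(k) - m(k+1) of a peer.\<close>
  then have "(\<lambda>j. - (1 / x) * (real (h j) * (\<Sum>k\<le>h j - 1. beta_binomial a b (h j - 1) k * (?m j (k + 1) - ?m j k))))
      \<longlonglongrightarrow> - (1 / x) * ?L"
    by (intro tendsto_intros)
  moreover have "- (1 / x) * (real (h j) * (\<Sum>k\<le>h j - 1. beta_binomial a b (h j - 1) k * (?m j (k + 1) - ?m j k)))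
     = (\<Sum>k\<le>h j - 1. beta_binomial a b (h j - 1) k *
        (alloc_min (\<lambda>i. \<Omega> i (\<eta> j)) (\<eta> j) S k - alloc_min (\<lambda>i. \<Omega> i (\<eta> j)) (\<eta> j) S (k + 1)))" for j
  proof -
    have "- (1 / x) * (real (h j) * (\<Sum>k\<le>h j - 1. beta_binomial a b (h j - 1) k * (?m j (k + 1) - ?m j k)))
      = - real (\<eta> j) * (\<Sum>k\<le>h j - 1. beta_binomial a b (h j - 1) k * (?m j (k + 1) - ?m j k))"
      using x_pos by (simp add: fraction)
    also have "\<dots> = (\<Sum>k\<le>h j - 1. beta_binomial a b (h j - 1) k * (real (\<eta> j) * ?m j k - real (\<eta> j) * ?m j (k + 1)))"
      unfolding sum_distrib_left by (intro sum.cong refl) (simp add: algebra_simps)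
    finally show ?thesis using eta_pos[of j] by (simp add: scaled_min_def)
  qed
  moreover have "- (1 / x) * ?L = - integral {0..1} (\<lambda>u. u ^ a * (1 - u) ^ b * deriv ?M (u * x))"
    unfolding integral_bernstein_times_deriv[OF x_pos reg sum_scaled_min_tendsto(1)[OF S] sum_scaled_min_tendsto(1)[OF S], symmetric]
    using x_pos by simp
  ultimately show ?thesis by simp
qed

end

text \<open>The weights sum to (u + (1 - u))^(card A) = 1 for every u. This evaluates the limit
  formula for \<open>x = 0\<close>, where the factor beside each weight does not depend on
  u.\<close>

lemma sum_integral_bernstein:
  fixes c :: real
  assumes "finite A"
  shows "(\<Sum>T\<in>Pow A. integral {0..1} (\<lambda>u. u ^ card T * (1 - u) ^ (card A - card T) * c)) = c"
proof -
  have "(\<Sum>T\<in>Pow A. integral {0..1} (\<lambda>u. u ^ card T * (1 - u) ^ (card A - card T) * c))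
     = integral {0..1} (\<lambda>u. \<Sum>T\<in>Pow A. u ^ card T * (1 - u) ^ (card A - card T) * c)"
    using assms by (intro integral_sum[symmetric] integrable_continuous_real continuous_intros) auto
  also have "(\<lambda>u. \<Sum>T\<in>Pow A. u ^ card T * (1 - u) ^ (card A - card T) * c) = (\<lambda>u. c)"
  proof
    fix u :: real
    have "(\<Sum>T\<in>Pow A. u ^ card T * (1 - u) ^ (card A - card T)) = (u + (1 - u)) ^ card A"
      using sum_Pow_card[OF assms, of "\<lambda>k. u ^ k * (1 - u) ^ (card A - k)"]
        binomial_ring[of u "1 - u" "card A"] by (simp only: mult.assoc)
    then show "(\<Sum>T\<in>Pow A. u ^ card T * (1 - u) ^ (card A - card T) * c) = c"
      by (simp add: sum_distrib_right[symmetric])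
  qed
  finally show ?thesis by simp
qed

theorem theorem1:
  fixes Z Zbar :: "'a set"
    and H Hbar :: "nat \<Rightarrow> 'a set"
    and \<eta> :: "nat \<Rightarrow> nat"
    and CS :: "nat \<Rightarrow> 'a set set"
    and \<Omega> :: "'a \<Rightarrow> nat \<Rightarrow> real \<Rightarrow> real"
    and \<Omega>t :: "'a \<Rightarrow> real \<Rightarrow> real"
    and x :: real
  assumes finite_Z: "finite Z"
    and cost_nonneg: "\<And>p m t. p \<in> Z \<Longrightarrow> 0 < m \<Longrightarrow> t \<in> {0..1} \<Longrightarrow> 0 \<le> \<Omega> p m t"
    and cost_antimono: "\<And>p m. p \<in> Z \<Longrightarrow> 0 < m \<Longrightarrow> antimono_on {0..1} (\<Omega> p m)"
    and fluid_limit: "\<And>p t. p \<in> Z \<Longrightarrow> t \<in> {0..1} \<Longrightarrow> (\<lambda>m. \<Omega> p m t / real m) \<longlonglongrightarrow> \<Omega>t p t"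
    and fluid_nonneg: "\<And>p t. p \<in> Z \<Longrightarrow> t \<in> {0..1} \<Longrightarrow> 0 \<le> \<Omega>t p t"
    and fluid_not_constant: "\<And>p. p \<in> Z \<Longrightarrow> \<not> \<Omega>t p constant_on {0..1}"
    and eta_pos: "\<And>j. 0 < \<eta> j"
    and eta_limit: "filterlim \<eta> at_top sequentially"
    and card_H: "\<And>j. card (H j) = \<eta> j"
    and disjoint: "\<And>j. Z \<inter> H j = {}"
    and Zbar: "Zbar \<subseteq> Z"
    and Hbar: "\<And>j. Hbar j \<subseteq> H j"
    and fraction: "\<And>j. x = real (card (Hbar j)) / real (\<eta> j)"
    and coalition_structure: "\<And>j. partition_on (Z \<union> H j) (CS j)"
    and coalition: "\<And>j. Zbar \<union> Hbar j \<in> CS j"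
  shows
    "(\<forall>p\<in>Zbar.
        (\<lambda>j. aumann_dreze (CS j) (worth Z (H j) \<Omega>) p / real (\<eta> j)) \<longlonglongrightarrow>
        \<Omega>t p 0 - (\<Sum>S\<in>Pow (Zbar - {p}). integral {0..1}
           (\<lambda>u. u ^ card S * (1 - u) ^ (card Zbar - 1 - card S) *
                (M_Omega \<Omega>t (S \<union> {p}) (u * x) - M_Omega \<Omega>t S (u * x))))) \<and>
     ((\<forall>S\<subseteq>Zbar. derivative_regular x (M_Omega \<Omega>t S)) \<longrightarrow>
      (\<forall>n. (\<forall>j. n j \<in> Hbar j) \<longrightarrow>
        (\<lambda>j. aumann_dreze (CS j) (worth Z (H j) \<Omega>) (n j)) \<longlonglongrightarrow>
        - (\<Sum>S\<in>Pow Zbar. integral {0..1}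
             (\<lambda>u. u ^ card S * (1 - u) ^ (card Zbar - card S) *
                  deriv (M_Omega \<Omega>t S) (u * x)))))"
proof -
  have finH: "finite (H j)" for j
    using card_H[of j] eta_pos[of j] by (metis card.infinite less_irrefl)
  have anti: "\<And>p. p \<in> Z \<Longrightarrow> antimono_on {0..1} (\<Omega> p (card (H j)))" for j
    using cost_antimono eta_pos card_H by simp
  have ad: "aumann_dreze (CS j) v i = shapley (Zbar \<union> Hbar j) v i" if "i \<in> Zbar \<union> Hbar j" for j v i
    by (rule aumann_dreze_eq_shapley[OF coalition_structure coalition that])
  have finZbar: "finite Zbar" using Zbar finite_Z finite_subset by blast
  have x: "0 \<le> x" "x \<le> 1"
  proof -
    show "0 \<le> x" by (simp add: fraction[of 0])
    have "card (Hbar 0) \<le> \<eta> 0" using card_mono[OF finH Hbar, of 0] card_H by simp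
    then show "x \<le> 1" using eta_pos[of 0] by (simp add: fraction[of 0])
  qed
  have Hbar_x: "real (card (Hbar j)) = x * real (\<eta> j)" for j
    using fraction[of j] eta_pos[of j] by simp
  have provider: "aumann_dreze (CS j) (worth Z (H j) \<Omega>) p = \<Omega> p (\<eta> j) 0
    - (\<Sum>T\<in>Pow (Zbar - {p}). \<Sum>k\<le>card (Hbar j). beta_binomial (card T) (card Zbar - 1 - card T) (card (Hbar j)) k *
        (alloc_min (\<lambda>i. \<Omega> i (\<eta> j)) (\<eta> j) (T \<union> {p}) k - alloc_min (\<lambda>i. \<Omega> i (\<eta> j)) (\<eta> j) T k))"
    if "p \<in> Zbar" for p j
    using shapley_provider[where \<Omega> = \<Omega> and H = "H j", OF finite_Z finH disjoint Zbar Hbar anti that] ad[of p j] that by (simp add: card_H)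
  have peer: "aumann_dreze (CS j) (worth Z (H j) \<Omega>) i =
    (\<Sum>T\<in>Pow Zbar. \<Sum>k\<le>card (Hbar j) - 1. beta_binomial (card T) (card Zbar - card T) (card (Hbar j) - 1) k *
        (alloc_min (\<lambda>i. \<Omega> i (\<eta> j)) (\<eta> j) T k - alloc_min (\<lambda>i. \<Omega> i (\<eta> j)) (\<eta> j) T (k + 1)))"
    if "i \<in> Hbar j" for i j
    using shapley_peer[where \<Omega> = \<Omega> and H = "H j", OF finite_Z finH disjoint Zbar Hbar anti that] ad[of i j] that by (simp add: card_H)
  show ?thesis
  proof (cases "x = 0")
    \<comment> \<open>Without peers, adding \<open>p\<close> raises every minimal cost by exactly
      its standalone cost. Its payoff is 0 for every j, the claimed limit is
      \<open>\<Omega>t p 0 - \<Omega>t p 0\<close>, and the claim about peers is vacuous.\<close>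
    case True
    then have no_peers: "card (Hbar j) = 0" for j using Hbar_x[of j] by simp
    have "finite (Hbar j)" for j using Hbar finH finite_subset by blast
    with no_peers have empty: "Hbar j = {}" for j by simp
    have "(\<lambda>j. aumann_dreze (CS j) (worth Z (H j) \<Omega>) p / real (\<eta> j)) \<longlonglongrightarrow>
        \<Omega>t p 0 - (\<Sum>S\<in>Pow (Zbar - {p}). integral {0..1}
           (\<lambda>u. u ^ card S * (1 - u) ^ (card Zbar - 1 - card S) *
                (M_Omega \<Omega>t (S \<union> {p}) (u * x) - M_Omega \<Omega>t S (u * x))))" if p: "p \<in> Zbar" for p
    proof -
      have finA: "finite (Zbar - {p})" and card: "card (Zbar - {p}) = card Zbar - 1"
        using finZbar p by auto
      have T: "finite T" "p \<notin> T" if "T \<in> Pow (Zbar - {p})" for T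
        using that finZbar finite_subset by blast+
      have "aumann_dreze (CS j) (worth Z (H j) \<Omega>) p = 0" for j
      proof -
        have "aumann_dreze (CS j) (worth Z (H j) \<Omega>) p = \<Omega> p (\<eta> j) 0
          - (\<Sum>T\<in>Pow (Zbar - {p}). beta_binomial (card T) (card Zbar - 1 - card T) 0 0 * \<Omega> p (\<eta> j) 0)"
          unfolding provider[OF p] no_peers using T by (auto intro!: sum.cong simp: alloc_min_0)
        also have "(\<Sum>T\<in>Pow (Zbar - {p}). beta_binomial (card T) (card Zbar - 1 - card T) 0 0 * \<Omega> p (\<eta> j) 0) = \<Omega> p (\<eta> j) 0"
          using sum_beta_binomial[OF finA, of "{}"] by (simp add: card sum_distrib_right[symmetric])
        finally show ?thesis by simp
      qed
      moreover have "(\<Sum>S\<in>Pow (Zbar - {p}). integral {0..1}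
           (\<lambda>u. u ^ card S * (1 - u) ^ (card Zbar - 1 - card S) *
                (M_Omega \<Omega>t (S \<union> {p}) (u * x) - M_Omega \<Omega>t S (u * x))))
         = (\<Sum>S\<in>Pow (Zbar - {p}). integral {0..1}
           (\<lambda>u. u ^ card S * (1 - u) ^ (card (Zbar - {p}) - card S) * \<Omega>t p 0))"
        using T True by (intro sum.cong refl) (simp add: card M_Omega_0)
      ultimately show ?thesis
        using sum_integral_bernstein[OF finA, of "\<Omega>t p 0"] by simp
    qed
    then show ?thesis using empty by auto
  next
    case False
    interpret fluid_costs Z \<Omega> \<Omega>t \<eta> "\<lambda>j. card (Hbar j)" x
      by unfold_locales (use False x finite_Z cost_nonneg cost_antimono fluid_limit eta_pos eta_limit Hbar_x in auto)
    show ?thesis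
    proof (intro conjI ballI impI allI)
      fix p assume p: "p \<in> Zbar"
      have eq: "aumann_dreze (CS j) (worth Z (H j) \<Omega>) p / real (\<eta> j) = \<Omega> p (\<eta> j) 0 / real (\<eta> j)
        - (\<Sum>T\<in>Pow (Zbar - {p}). \<Sum>k\<le>card (Hbar j). beta_binomial (card T) (card Zbar - 1 - card T) (card (Hbar j)) k *
            (scaled_min (T \<union> {p}) j k - scaled_min T j k))" for j
        unfolding provider[OF p] scaled_min_def diff_divide_distrib[symmetric] times_divide_eq_right
          sum_divide_distrib[symmetric] ..
      show "(\<lambda>j. aumann_dreze (CS j) (worth Z (H j) \<Omega>) p / real (\<eta> j)) \<longlonglongrightarrow>
        \<Omega>t p 0 - (\<Sum>S\<in>Pow (Zbar - {p}). integral {0..1}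
           (\<lambda>u. u ^ card S * (1 - u) ^ (card Zbar - 1 - card S) *
                (M_Omega \<Omega>t (S \<union> {p}) (u * x) - M_Omega \<Omega>t S (u * x))))"
        unfolding eq
      proof (intro tendsto_diff tendsto_sum)
        show "(\<lambda>j. \<Omega> p (\<eta> j) 0 / real (\<eta> j)) \<longlonglongrightarrow> \<Omega>t p 0"
          by (rule filterlim_compose[OF fluid_limit eta_limit]) (use p Zbar in auto)
      qed (rule sum_marginal_cost_tendsto, use p Zbar in auto)
    next
      fix n assume reg: "\<forall>S\<subseteq>Zbar. derivative_regular x (M_Omega \<Omega>t S)" and n: "\<forall>j. n j \<in> Hbar j"
      show "(\<lambda>j. aumann_dreze (CS j) (worth Z (H j) \<Omega>) (n j)) \<longlonglongrightarrow>
        - (\<Sum>S\<in>Pow Zbar. integral {0..1}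
             (\<lambda>u. u ^ card S * (1 - u) ^ (card Zbar - card S) *
                  deriv (M_Omega \<Omega>t S) (u * x)))"
        unfolding peer[OF n[rule_format]] sum_negf[symmetric]
        by (intro tendsto_sum sum_peer_marginal_tendsto) (use reg Zbar in auto)
    qed
  qed
qed


end
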